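(* Let $n\le m$ be positive integers and let $k$ be an integer with $0\le k\le n-1$. The number of standard Young tableaux of truncated straight shape $\underbrace{(n,n,\ldots,n)}_{m}\setminus\delta_k$ is $$\binom{mn-\binom{k+1}{2}}{m(n-k-1)}\; f_{(n-k-1)^m}\; g_{(m,m-1,\ldots,m-k)}\;\frac{E_1(k+1,m,n-k-1)}{E_1(k+1,m,0)},$$ where, for $r$ even, $$E_1(r,p,s)=\prod_{r<l<2p-r+2}\frac{1}{(l+2s)^{r/2}}\;\prod_{2\le l\le r}\frac{1}{\big((l+2s)(2p-l+2+2s)\big)^{\lfloor l/2\rfloor}},$$ and, for $r$ odd, $$E_1(r,p,s)=\frac{\big(\frac{r-1}{2}+s\big)!}{\big(p-\frac{r-1}{2}+s\big)!}\,E_1(r-1,p,s)$$ (the products are over integers $l$ in the indicated ranges, empty products being $1$).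
   Context: Here $\delta_k=(k,k-1,\ldots,1)$. For integer partitions $\lambda,\mu$ with $\lambda_i\ge\mu_i$ for all $i$ (with $\mu_i=0$ beyond the length of $\mu$), the straight diagram of truncated shape $\lambda\setminus\mu$ is the left-justified array of boxes whose row $i$ (counted from the top) has $\lambda_i-\mu_i$ boxes. Thus $(n,\ldots,n)\setminus\delta_k$ ($m$ rows) has row lengths $n-k,n-k+1,\ldots,n-1,n,\ldots,n$. A standard Young tableau of such a shape with $N$ boxes is a filling of the boxes with $1,\ldots,N$, each used exactly once, with entries increasing along rows and down columns. $f_\lambda$ denotes the number of standard Young tableaux of ordinary straight shape $\lambda$, and $(a)^m=(a,\ldots,a)$ with $m$ parts (for $a=0$ this is the empty shape, with $f=1$). $g_\lambda$, for $\lambda$ with distinct parts, denotes the number of standard Young tableaux of shifted shape $\lambda$ (row $i$ has $\lambda_i$ boxes and starts one box to the right of where row $i-1$ starts; entries $1,\ldots,|\lambda|$, each used once, increase along rows and down columns). *)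

theory Defs
  imports Complex_Main "HOL-Library.FuncSet"
begin

(* A diagram is a set of boxes (row, column); rows and columns are numbered from 0,
   rows from top to bottom and columns from left to right. *)

type_synonym diagram = "(nat \<times> nat) set"

definition part :: "nat list \<Rightarrow> nat \<Rightarrow> nat" where
  "part \<alpha> i = (if i < length \<alpha> then \<alpha> ! i else 0)"

definition straight_diagram :: "nat list \<Rightarrow> diagram" where
  "straight_diagram \<alpha> = {(i, j). j < part \<alpha> i}"

(* Only meaningful when part \<mu> i \<le> part \<alpha> i for all i, because of the subtraction on nat.
   This is not a skew shape: all rows are left-justified. *)
definition truncated_diagram :: "nat list \<Rightarrow> nat list \<Rightarrow> diagram" where
  "truncated_diagram \<alpha> \<mu> = {(i, j). j < part \<alpha> i - part \<mu> i}"

definition shifted_diagram :: "nat list \<Rightarrow> diagram" where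
  "shifted_diagram \<alpha> = {(i, j). i \<le> j \<and> j < i + part \<alpha> i}"

(* Fillings are functions on all of nat \<times> nat; extensionality fixes their values outside the
   diagram, so that each tableau is counted exactly once. *)
definition standard_tableaux :: "diagram \<Rightarrow> (nat \<times> nat \<Rightarrow> nat) set" where
  "standard_tableaux D = {T \<in> extensional D.
     bij_betw T D {1..card D} \<and>
     (\<forall>i j j'. (i, j) \<in> D \<longrightarrow> (i, j') \<in> D \<longrightarrow> j < j' \<longrightarrow> T (i, j) < T (i, j')) \<and>
     (\<forall>i i' j. (i, j) \<in> D \<longrightarrow> (i', j) \<in> D \<longrightarrow> i < i' \<longrightarrow> T (i, j) < T (i', j))}"

definition num_syt :: "diagram \<Rightarrow> nat" where
  "num_syt D = card (standard_tableaux D)"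

definition f_straight :: "nat list \<Rightarrow> nat" where
  "f_straight \<alpha> = num_syt (straight_diagram \<alpha>)"

definition g_shifted :: "nat list \<Rightarrow> nat" where
  "g_shifted \<alpha> = num_syt (shifted_diagram \<alpha>)"

definition staircase :: "nat \<Rightarrow> nat list" where
  "staircase k = map (\<lambda>i. k - i) [0..<k]"

(* The index range r < l < 2 p - r + 2 is written without truncated subtraction problems:
   {r<..<2 * p + 2 - r} is empty when r > 2 p + 2. *)
definition E1_even :: "nat \<Rightarrow> nat \<Rightarrow> nat \<Rightarrow> real" where
  "E1_even r p s =
     (\<Prod>l\<in>{r<..<2 * p + 2 - r}. 1 / (real l + 2 * real s) ^ (r div 2)) *
     (\<Prod>l\<in>{2..r}. 1 / ((real l + 2 * real s) *
                        (2 * real p - real l + 2 + 2 * real s)) ^ (l div 2))"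

(* The factorial argument p - (r - 1) / 2 + s is nonnegative whenever r \<le> p. *)
definition E1 :: "nat \<Rightarrow> nat \<Rightarrow> nat \<Rightarrow> real" where
  "E1 r p s =
     (if even r then E1_even r p s
      else fact ((r - 1) div 2 + s) / fact (p + s - (r - 1) div 2) * E1_even (r - 1) p s)"

end

theory Submission
  imports Defs "HOL-Probability.Probability" "Jordan_Normal_Form.Determinant"
begin

text \<open>
  The number of standard tableaux of a diagram with \<open>N\<close> boxes is \<open>N!\<close> times the volume of its order
  polytope in the unit cube, so the theorem is about volumes. The diagram is swept from its lower left
  corner, one diagonal at a time. Given the entries of a diagonal, the entries of the preceding one range
  over a box whose sides are delimited by consecutive entries (and possibly \<open>0\<close> and \<open>1\<close>), and a
  determinant computation, the case of unit exponents of the Dixon--Anderson integral, shows by induction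
  that the joint density of the \<open>r\<close> entries of a diagonal is always a constant times
  \<open>\<Prod>u\<^sub>t^a (1 - u\<^sub>t)^b \<Prod>\<^bsub>i<j\<^esub> (u\<^sub>j - u\<^sub>i)\<close>. The last diagonal of the truncated shape has
  \<open>r = k + 1\<close>, \<open>a = n - k - 1\<close> and \<open>b = m - k - 1\<close>; rectangles are the case \<open>r = 0\<close>, and the (transposed)
  shifted trapezoid is the case \<open>a = 0\<close>. The constants multiply correctly, and the quotient of the two
  remaining integrals, Selberg integrals with \<open>\<gamma> = 1/2\<close>, follows from Aomoto's recurrence in \<open>a\<close>.
\<close>

text \<open>The staircase is cut off exactly along a diagonal, so the truncated shape is an initial
  segment of the sweep. The upper and right neighbours of a box lie on the next diagonal, as
  consecutive boxes of it, the left and lower neighbours on the preceding one. A diagonal therefore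
  separates what was swept from what is still to come, and only its own law has to be carried along.
  A missing right neighbour puts the bound 1 in its place and thereby raises the exponent
  \<open>b\<close>; a missing upper neighbour puts 0 there and raises \<open>a\<close>. No Selberg
  integral is ever evaluated. The shifted trapezoid has the same \<open>r\<close> and
  \<open>b\<close> as the truncated shape and differs only in \<open>a\<close>, so only the ratio
  between \<open>a = s\<close> and \<open>a = 0\<close> matters; \<open>E1\<close> and the integral
  satisfy the same first-order recurrence in \<open>s\<close>. That recurrence comes from
  integrating by parts over ordered points. The Vandermonde product occurs to the first power, which
  is twice the Selberg exponent 1/2. It vanishes where neighbouring points meet, and this removes
  the boundary terms.\<close>

subsection \<open>The shift of the parameter s in E1\<close>

text \<open>Raising \<open>s\<close> by one moves every factor two places up, so the quotient of the
  products telescopes to two factors at each end. The bound \<open>a \<le> Suc b\<close> admits the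
  empty range, where the induction starts.\<close>

lemma prod_inverse_shift_two:
  fixes s :: nat
  assumes "1 \<le> a" "a \<le> Suc b"
  shows "(\<Prod>l\<in>{a..b}. 1 / (real l + 2 * real (Suc s))) * ((real b + 1 + 2 * real s) * (real b + 2 + 2 * real s))
    = (\<Prod>l\<in>{a..b}. 1 / (real l + 2 * real s)) * ((real a + 2 * real s) * (real a + 1 + 2 * real s))"
  using assms(2)
proof (induction b)
  case 0
  then have "a = 1" using assms(1) by simp
  then show ?case by (simp add: algebra_simps)
next
  case (Suc b)
  show ?case
  proof (cases "a = Suc (Suc b)")
    case True
    then show ?thesis by (simp add: algebra_simps)
  next
    case False
    then have le: "a \<le> Suc b" using Suc.prems by simp
    define x where "x = real b + 1 + 2 * real s"
    have x: "x > 0" by (simp add: x_def)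
    define P where "P = (\<Prod>l\<in>{a..b}. 1 / (real l + 2 * real (Suc s)))"
    define Q where "Q = (\<Prod>l\<in>{a..b}. 1 / (real l + 2 * real s))"
    define A where "A = (real a + 2 * real s) * (real a + 1 + 2 * real s)"
    have IH: "P * (x * (x + 1)) = Q * A"
      using Suc.IH[OF le] by (simp add: P_def Q_def A_def x_def algebra_simps)
    have e: "{a..Suc b} = insert (Suc b) {a..b}" using le by auto
    have P': "(\<Prod>l\<in>{a..Suc b}. 1 / (real l + 2 * real (Suc s))) = P / (x + 2)"
      and Q': "(\<Prod>l\<in>{a..Suc b}. 1 / (real l + 2 * real s)) = Q / x"
      by (simp_all add: e P_def Q_def x_def algebra_simps)
    have b: "real (Suc b) + 1 + 2 * real s = x + 1" "real (Suc b) + 2 + 2 * real s = x + 2"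
      by (simp_all add: x_def)
    have "P / (x + 2) * ((x + 1) * (x + 2)) = P * (x + 1)" using x by simp
    also have "\<dots> = Q / x * A" using IH x by (simp add: field_simps)
    finally show ?thesis unfolding P' Q' b A_def .
  qed
qed

text \<open>Put \<open>q = 2 * p - 2 * h\<close>. The first product loses the indices
  \<open>2 * h + 1\<close>, \<open>2 * h + 2\<close>, \<open>q\<close>, \<open>q + 1\<close>, all
  with exponent \<open>h\<close>. The second regains the outer two with exponent \<open>h\<close>
  and the inner two with exponent \<open>h + 1\<close>. Every index in between gains one in its
  exponent, so one copy of the range from \<open>2 * h + 2\<close> to \<open>q\<close>
  remains.\<close>

lemma E1_even_Suc:
  assumes "2 * Suc h \<le> p"
  shows "E1_even (2 * Suc h) p s =
    E1_even (2 * h) p s * (\<Prod>l\<in>{2 * h + 2..2 * p - 2 * h}. 1 / (real l + 2 * real s))"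
proof -
  define x where "x l = real l + 2 * real s" for l
  have x: "x l > 0" if "l > 0" for l using that by (simp add: x_def)
  define q where "q = 2 * p - 2 * h"
  have q: "2 * h + 4 \<le> q" "q \<le> 2 * p" using assms by (auto simp: q_def)
  have xq: "2 * real p - real (2*h+1) + 2 + 2 * real s = x (Suc q)"
    "2 * real p - real (2*h+2) + 2 + 2 * real s = x q"
    using assms by (auto simp: x_def q_def of_nat_diff)
  have r1: "{2 * h<..<2 * p + 2 - 2 * h} = {2*h+1, 2*h+2, q, Suc q} \<union> {2 * Suc h<..<2 * p + 2 - 2 * Suc h}"
    using q assms by (auto simp: q_def)
  have r2: "{2*h+2..2 * p - 2 * h} = {2*h+2, q} \<union> {2 * Suc h<..<2 * p + 2 - 2 * Suc h}"
    using q assms by (auto simp: q_def)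
  \<comment> \<open>For \<open>h = 0\<close> the index \<open>2 * h + 1\<close> is 1 and lies
    outside the range; its exponent would be 0, so the quotient has the same form in both
    cases.\<close>
  have r3: "{2..2 * Suc h} = {2..2*h} \<union> (if h = 0 then {2} else {2*h+1, 2*h+2})" by auto
  define M where "M = {2 * Suc h<..<2 * p + 2 - 2 * Suc h}"
  define Z where "Z = (\<Prod>l\<in>M. x l)"
  have Z: "Z > 0" unfolding Z_def by (intro prod_pos x) (auto simp: M_def)
  define B where "B = (\<Prod>l\<in>{2..2*h}. 1 / ((real l + 2 * real s) *
                        (2 * real p - real l + 2 + 2 * real s)) ^ (l div 2))"
  have fin: "finite M" by (simp add: M_def)
  have Zp: "(\<Prod>l\<in>M. 1 / x l ^ k) = 1 / Z ^ k" for k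
    by (simp add: Z_def prod_dividef prod_power_distrib)
  have d: "(\<Prod>l\<in>{2*h+1, 2*h+2, q, Suc q} \<union> M. g l) = g (2*h+1) * g (2*h+2) * g q * g (Suc q) * (\<Prod>l\<in>M. g l)"
    "(\<Prod>l\<in>{2*h+2, q} \<union> M. g l) = g (2*h+2) * g q * (\<Prod>l\<in>M. g l)" for g :: "nat \<Rightarrow> real"
    using q fin by (subst prod.union_disjoint; auto simp: M_def q_def)+
  have E0: "E1_even (2*h) p s = 1 / (x (2*h+1) * x (2*h+2) * x q * x (Suc q) * Z) ^ h * B"
    unfolding E1_even_def B_def[symmetric] r1 unfolding x_def[symmetric] M_def[symmetric] d
    using Zp[of h] by (simp only: power_mult_distrib) simp
  have B': "(\<Prod>l\<in>{2..2*Suc h}. 1 / ((real l + 2 * real s) *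
                        (2 * real p - real l + 2 + 2 * real s)) ^ (l div 2))
        = B / (x (2*h+1) * x (Suc q)) ^ h / (x (2*h+2) * x q) ^ (Suc h)"
  proof (cases "h = 0")
    case True
    then show ?thesis using xq by (simp add: B_def x_def[symmetric]) (simp add: x_def)
  next
    case False
    have "(\<Prod>l\<in>{2..2*Suc h}. 1 / ((real l + 2 * real s) *
                        (2 * real p - real l + 2 + 2 * real s)) ^ (l div 2)) = 
        (1 / ((real (2*h+1) + 2 * real s) * (2 * real p - real (2*h+1) + 2 + 2 * real s)) ^ ((2*h+1) div 2)) *
        (1 / ((real (2*h+2) + 2 * real s) * (2 * real p - real (2*h+2) + 2 + 2 * real s)) ^ ((2*h+2) div 2)) * B"
      unfolding r3 B_def using False by (subst prod.union_disjoint) auto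
    also have "\<dots> = B / (x (2*h+1) * x (Suc q)) ^ h / (x (2*h+2) * x q) ^ (Suc h)"
      unfolding xq x_def[symmetric] by simp
    finally show ?thesis .
  qed
  have E2: "E1_even (2*Suc h) p s = 1 / Z ^ Suc h * (B / (x (2*h+1) * x (Suc q)) ^ h / (x (2*h+2) * x q) ^ (Suc h))"
    unfolding E1_even_def B' unfolding x_def[symmetric] M_def[symmetric] using Zp[of "Suc h"] by simp
  have R: "(\<Prod>l\<in>{2*h+2..2 * p - 2 * h}. 1 / (real l + 2 * real s)) = 1 / (x (2*h+2) * x q * Z)"
    unfolding r2 x_def[symmetric] M_def[symmetric] d using Zp[of 1] by simp
  show ?thesis unfolding E0 E2 R
    using x[of "2*h+1"] x[of "2*h+2"] x[of q] x[of "Suc q"] Z q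
    by (simp add: field_simps power_mult_distrib)
qed

text \<open>Each step of \<open>E1_even_Suc\<close> contributes a telescoped quotient of two factors
  by two. The right-hand product grows at its upper end, the left-hand one at its lower end, since
  its starting value drops by two.\<close>

lemma E1_even_shift:
  assumes "2 * h \<le> p"
  shows "E1_even (2 * h) p (Suc s) * (\<Prod>j<2 * h. 2 * real s + 2 * real p - real (2 * h) + 3 + real j)
    = E1_even (2 * h) p s * (\<Prod>j<2 * h. 2 * real s + 2 + real j)"
  using assms
proof (induction h)
  case 0
  then show ?case by (simp add: E1_even_def)
next
  case (Suc h)
  define P Q where "P = (\<Prod>l\<in>{2 * h + 2..2 * p - 2 * h}. 1 / (real l + 2 * real (Suc s)))"
    and "Q = (\<Prod>l\<in>{2 * h + 2..2 * p - 2 * h}. 1 / (real l + 2 * real s))"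
  define a where "a = 2 * real s + 2 * real p - 2 * real h"
  define c where "c = 2 * real s + 2 + 2 * real h"
  have "real (2 * p - 2 * h) = 2 * real p - 2 * real h" using Suc.prems by (simp add: of_nat_diff)
  then have PQ: "P * ((a + 1) * (a + 2)) = Q * (c * (c + 1))"
    using prod_inverse_shift_two[of "2*h+2" "2*p-2*h" s] Suc.prems
    by (simp add: P_def Q_def a_def c_def algebra_simps)
  have num: "(\<Prod>j<2 * Suc h. 2 * real s + 2 + real j) = (\<Prod>j<2 * h. 2 * real s + 2 + real j) * (c * (c + 1))"
    by (simp add: c_def algebra_simps)
  have "(\<Prod>j<2 * Suc h. 2 * real s + 2 * real p - real (2 * Suc h) + 3 + real j)
      = (\<Prod>j<Suc (Suc (2*h)). a + 1 + real j)" by (intro prod.cong) (auto simp: a_def)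
  also have "\<dots> = (a + 1) * (a + 2) * (\<Prod>j<2 * h. a + 3 + real j)"
    by (simp add: prod.lessThan_Suc_shift del: prod.lessThan_Suc) (simp add: algebra_simps)
  also have "(\<Prod>j<2 * h. a + 3 + real j) = (\<Prod>j<2 * h. 2 * real s + 2 * real p - real (2 * h) + 3 + real j)"
    by (simp add: a_def)
  finally have den: "(\<Prod>j<2 * Suc h. 2 * real s + 2 * real p - real (2 * Suc h) + 3 + real j)
      = (a + 1) * (a + 2) * (\<Prod>j<2 * h. 2 * real s + 2 * real p - real (2 * h) + 3 + real j)" .
  have "E1_even (2 * Suc h) p (Suc s) * (\<Prod>j<2 * Suc h. 2 * real s + 2 * real p - real (2 * Suc h) + 3 + real j)
    = (E1_even (2 * h) p (Suc s) * (\<Prod>j<2 * h. 2 * real s + 2 * real p - real (2 * h) + 3 + real j)) * (P * ((a + 1) * (a + 2)))"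
    unfolding den E1_even_Suc[OF Suc.prems] P_def[symmetric] by (simp only: mult_ac)
  also have "\<dots> = (E1_even (2 * h) p s * (\<Prod>j<2 * h. 2 * real s + 2 + real j)) * (Q * (c * (c + 1)))"
    using Suc.IH Suc.prems by (simp add: PQ)
  also have "\<dots> = E1_even (2 * Suc h) p s * (\<Prod>j<2 * Suc h. 2 * real s + 2 + real j)"
    unfolding num E1_even_Suc[OF Suc.prems] Q_def[symmetric] by (simp only: mult_ac)
  finally show ?case .
qed

text \<open>For odd \<open>r\<close> the factorials add the quotient
  \<open>(h + s + 1) / (p + s - h + 1)\<close>; doubled, its two parts are the last factor on the
  right and the first factor on the left. With \<open>b = p - r\<close> this is the recurrence of
  \<open>selberg_integral_shift\<close>.\<close>

lemma E1_shift:
  assumes "r \<le> p"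
  shows "E1 r p (Suc s) * (\<Prod>j<r. 2 * real s + 2 * real p - real r + 3 + real j)
    = E1 r p s * (\<Prod>j<r. 2 * real s + 2 + real j)"
proof (cases "even r")
  case True
  then obtain h where h: "r = 2 * h" by blast
  then show ?thesis using E1_even_shift[of h p s] assms by (simp add: E1_def)
next
  case False
  then obtain h where h: "r = 2 * h + 1" by (auto elim: oddE)
  define P where "P = (\<Prod>j<2 * h. 2 * real s + 2 * real p - real (2 * h) + 3 + real j)"
  define Q where "Q = (\<Prod>j<2 * h. 2 * real s + 2 + real j)"
  have IH: "E1_even (2 * h) p (Suc s) * P = E1_even (2 * h) p s * Q"
    using E1_even_shift[of h p s] assms by (simp add: h P_def Q_def)
  have p: "p + Suc s - h = Suc (p + s - h)" using assms h by simp
  define c where "c = real (p + s - h) + 1"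
  have c: "c = real p + real s - real h + 1" "c > 0" using assms h by (auto simp: c_def of_nat_diff)
  have "(\<Prod>j<r. 2 * real s + 2 * real p - real r + 3 + real j) = 2 * c * P"
    by (simp add: h prod.lessThan_Suc_shift P_def c(1) del: prod.lessThan_Suc) (simp add: algebra_simps)
  moreover have "(\<Prod>j<r. 2 * real s + 2 + real j) = 2 * (real h + real s + 1) * Q"
    by (simp add: h Q_def)
  moreover have "E1 r p (Suc s) = (real h + real s + 1) * fact (h + s) / (c * fact (p + s - h)) * E1_even (2 * h) p (Suc s)"
    using p by (simp add: E1_def h c_def algebra_simps)
  moreover have "E1 r p s = fact (h + s) / fact (p + s - h) * E1_even (2 * h) p s"
    by (simp add: E1_def h)
  moreover have "(real h + real s + 1) * fact (h + s) / (c * fact (p + s - h)) * E1_even (2 * h) p (Suc s) * (2 * c * P)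
     = (real h + real s + 1) * fact (h + s) / fact (p + s - h) * 2 * (E1_even (2 * h) p (Suc s) * P)"
    using c(2) by (simp add: field_simps)
  moreover have "\<dots> = fact (h + s) / fact (p + s - h) * E1_even (2 * h) p s * (2 * (real h + real s + 1) * Q)"
    unfolding IH by simp
  ultimately show ?thesis by metis
qed

lemma E1_pos:
  assumes "r \<le> p"
  shows "E1 r p s > 0"
proof -
  have E: "E1_even r' p s > 0" if "r' \<le> p" for r'
    unfolding E1_even_def
  proof (intro mult_pos_pos prod_pos)
    fix l assume l: "l \<in> {2..r'}"
    have "2 * real p - real l + 2 + 2 * real s > 0" using l that by simp
    then show "0 < 1 / ((real l + 2 * real s) * (2 * real p - real l + 2 + 2 * real s)) ^ (l div 2)"
      using l by simp
  qed auto
  show ?thesis using E[of r] E[of "r - 1"] assms by (simp add: E1_def)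
qed

subsection \<open>Integrals of Vandermonde determinants over boxes\<close>

definition vandermonde :: "nat \<Rightarrow> (nat \<Rightarrow> real) \<Rightarrow> real" where
  "vandermonde N u = (\<Prod>j<N. \<Prod>i<j. u j - u i)"

lemma vandermonde_0 [simp]: "vandermonde 0 u = 1"
  by (simp add: vandermonde_def)

lemma vandermonde_Suc: "vandermonde (Suc N) u = vandermonde N u * (\<Prod>i<N. u N - u i)"
  by (simp add: vandermonde_def)

section \<open>Determinants with polynomial columns and bordered matrices\<close>

lemma det_polynomial_columns:
  fixes p :: "nat \<Rightarrow> real poly"
  assumes "\<And>k. k < N \<Longrightarrow> degree (p k) \<le> k"
  shows "det (mat N N (\<lambda>(t, k). poly (p k) (u t))) =
    (\<Prod>k<N. coeff (p k) k) * det (mat N N (\<lambda>(t, k). u t ^ k))"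
proof -
  define C where "C = mat N N (\<lambda>(i, k). coeff (p k) i)"
  define V where "V = mat N N (\<lambda>(t, k). u t ^ k)"
  have c: "C \<in> carrier_mat N N" "V \<in> carrier_mat N N" by (auto simp: C_def V_def)
  have "mat N N (\<lambda>(t, k). poly (p k) (u t)) = V * C"
  proof (rule eq_matI)
    fix t k assume "t < dim_row (V * C)" "k < dim_col (V * C)"
    then have tk: "t < N" "k < N" by (auto simp: C_def V_def)
    have "poly (p k) (u t) = (\<Sum>i\<le>degree (p k). coeff (p k) i * u t ^ i)"
      by (rule poly_altdef)
    also have "\<dots> = (\<Sum>i<N. coeff (p k) i * u t ^ i)"
      using assms[OF tk(2)] tk by (intro sum.mono_neutral_left) (auto simp: coeff_eq_0)
    finally show "mat N N (\<lambda>(t, k). poly (p k) (u t)) $$ (t, k) = (V * C) $$ (t, k)"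
      using tk by (simp add: C_def V_def scalar_prod_def lessThan_atLeast0 mult.commute)
  qed (auto simp: C_def V_def)
  moreover have "det C = (\<Prod>k<N. coeff (p k) k)"
  proof -
    have "upper_triangular C"
      by (auto simp: C_def upper_triangular_def intro!: coeff_eq_0 le_less_trans[OF assms])
    then have "det C = prod_list (diag_mat C)" using c(1) by (rule det_upper_triangular)
    also have "diag_mat C = map (\<lambda>k. coeff (p k) k) [0..<N]" by (auto simp: diag_mat_def C_def)
    also have "prod_list \<dots> = (\<Prod>k<N. coeff (p k) k)"
      by (simp add: prod.distinct_set_conv_list[symmetric] lessThan_atLeast0 prod.list_conv_set_nth)
    finally show ?thesis .
  qed
  ultimately show ?thesis using c by (simp add: det_mult[of _ N] V_def[symmetric])
qed

lemma det_unit_row: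
  fixes A :: "real mat"
  assumes "A \<in> carrier_mat (Suc N) (Suc N)" "k \<le> N" "\<And>j. j \<le> N \<Longrightarrow> j \<noteq> k \<Longrightarrow> A $$ (i, j) = 0" "i \<le> N"
  shows "det A = A $$ (i, k) * cofactor A i k"
proof -
  have "det A = (\<Sum>j<Suc N. A $$ (i,j) * cofactor A i j)"
    using assms by (intro laplace_expansion_row) auto
  also have "\<dots> = (\<Sum>j\<in>{k}. A $$ (i,j) * cofactor A i j)"
    using assms by (intro sum.mono_neutral_right) auto
  finally show ?thesis by simp
qed

text \<open>Column operations replace the last column by the values of the monic polynomial with
  roots \<open>u 0, ..., u (N - 1)\<close>. Only its last entry survives, and expanding there lowers
  the size by one.\<close>

lemma det_vandermonde: "det (mat N N (\<lambda>(t, k). u t ^ k)) = vandermonde N u"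
proof (induction N)
  case 0
  then show ?case by simp
next
  case (Suc N)
  define p where "p k = (if k < N then monom 1 k else (\<Prod>i<N. [:- u i, 1:]))" for k
  have deg: "degree (\<Prod>i<N. [:- u i, 1:]) = N" for N
    by (subst degree_prod_eq_sum_degree) auto
  have mon: "coeff (\<Prod>i<N. [:- u i, 1:]) N = 1" for N
    using lead_coeff_prod[of "\<lambda>i. [:- u i, 1:]" "{..<N}"] by (simp add: deg)
  have "det (mat (Suc N) (Suc N) (\<lambda>(t, k). poly (p k) (u t))) = 
    (\<Prod>k<Suc N. coeff (p k) k) * det (mat (Suc N) (Suc N) (\<lambda>(t, k). u t ^ k))"
    by (rule det_polynomial_columns) (auto simp: p_def deg degree_monom_eq)
  also have "(\<Prod>k<Suc N. coeff (p k) k) = 1" by (simp add: p_def mon)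
  finally have *: "det (mat (Suc N) (Suc N) (\<lambda>(t, k). u t ^ k)) = det (mat (Suc N) (Suc N) (\<lambda>(t, k). poly (p k) (u t)))"
    by simp
  define A where "A = mat (Suc N) (Suc N) (\<lambda>(t, k). poly (p k) (u t))"
  have A: "A \<in> carrier_mat (Suc N) (Suc N)" by (simp add: A_def)
  have "det A = (\<Sum>i<Suc N. A $$ (i,N) * cofactor A i N)"
    using A by (intro laplace_expansion_column) auto
  also have "\<dots> = (\<Sum>i\<in>{N}. A $$ (i,N) * cofactor A i N)"
    by (intro sum.mono_neutral_right) (auto simp: A_def p_def poly_prod)
  also have "\<dots> = (\<Prod>i<N. u N - u i) * cofactor A N N" by (simp add: A_def p_def poly_prod)
  also have "cofactor A N N = det (mat_delete A N N)" by (simp add: cofactor_def)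
  also have "mat_delete A N N = mat N N (\<lambda>(t, k). u t ^ k)"
    by (rule eq_matI) (auto simp: mat_delete_def A_def p_def poly_monom)
  finally show ?case using Suc.IH by (simp add: * A_def[symmetric] vandermonde_Suc)
qed

text \<open>The bordered matrix, multiplied by the unit lower triangular difference matrix, has first column \<open>(1, 0, \<dots>, 0)\<close>.\<close>

lemma det_differences:
  fixes F :: "nat \<Rightarrow> real \<Rightarrow> real"
  shows "det (mat N N (\<lambda>(t, k). F k (w (Suc t)) - F k (w t))) =
    det (mat (Suc N) (Suc N) (\<lambda>(t, k). if k = 0 then 1 else F (k - 1) (w t)))"
proof -
  define B where "B = mat (Suc N) (Suc N) (\<lambda>(t, k). if k = 0 then 1 else F (k - 1) (w t))"
  define L where "L = mat (Suc N) (Suc N) (\<lambda>(i, j). if i = j then 1 else if i = Suc j then - 1 else (0::real))"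
  have c: "L \<in> carrier_mat (Suc N) (Suc N)" "B \<in> carrier_mat (Suc N) (Suc N)" by (auto simp: B_def L_def)
  have B_at: "B $$ (t, k) = (if k = 0 then 1 else F (k - 1) (w t))" if "t < Suc N" "k < Suc N" for t k
    using that by (simp add: B_def)
  have "det L = prod_list (diag_mat L)"
    by (rule det_lower_triangular[OF _ c(1)]) (auto simp: L_def)
  also have "diag_mat L = map (\<lambda>_. 1) [0..<Suc N]" by (auto simp: diag_mat_def L_def simp del: upt_Suc)
  also have "prod_list \<dots> = (1::real)" by (induction N) auto
  finally have detL: "det L = 1" .
  have LB: "(L * B) $$ (t, k) = (if t = 0 then B $$ (0, k) else B $$ (t, k) - B $$ (t - 1, k))"
    if "t < Suc N" "k < Suc N" for t k
  proof -
    have "(L * B) $$ (t, k) = (\<Sum>j<Suc N. L $$ (t, j) * B $$ (j, k))"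
      using that c by (simp add: scalar_prod_def lessThan_atLeast0 del: sum.op_ivl_Suc)
    also have "\<dots> = (\<Sum>j\<in>(if t = 0 then {0} else {t, t - 1}). L $$ (t, j) * B $$ (j, k))"
      using that by (intro sum.mono_neutral_right) (auto simp: L_def split: if_splits)
    also have "\<dots> = (if t = 0 then B $$ (0, k) else B $$ (t, k) - B $$ (t - 1, k))"
      using that by (auto simp: L_def)
    finally show ?thesis .
  qed
  have "det B = det (L * B)" using c by (simp add: det_mult detL)
  also have "\<dots> = (\<Sum>i<Suc N. (L * B) $$ (i, 0) * cofactor (L * B) i 0)"
    using c by (intro laplace_expansion_column) auto
  also have "\<dots> = (\<Sum>i\<in>{0}. (L * B) $$ (i, 0) * cofactor (L * B) i 0)"
    by (intro sum.mono_neutral_right) (auto simp: LB B_at simp del: index_mult_mat)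
  also have "\<dots> = det (mat_delete (L * B) 0 0)"
    by (simp add: LB cofactor_def B_at del: index_mult_mat)
  also have "mat_delete (L * B) 0 0 = mat N N (\<lambda>(t, k). F k (w (Suc t)) - F k (w t))"
    using c by (intro eq_matI) (auto simp: mat_delete_def LB B_at simp del: index_mult_mat(1))
  finally show ?thesis by (simp add: B_def)
qed


lemma det_scale_rows:
  "det (mat N N (\<lambda>(t, k). c t * g t k)) = (\<Prod>t<N. c t) * det (mat N N (\<lambda>(t, k). g t k :: real))"
proof -
  have "det (mat N N (\<lambda>(t, k). c t * g t k)) =
    (\<Sum>p\<in>{p. p permutes {0..<N}}. signof p * (\<Prod>i=0..<N. c i * g i (p i)))"
    by (subst det_def'[of _ N]) (auto intro!: sum.cong arg_cong2[where f = "(*)"] prod.cong simp: permutes_def)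
  also have "\<dots> = (\<Prod>t<N. c t) * (\<Sum>p\<in>{p. p permutes {0..<N}}. signof p * (\<Prod>i=0..<N. g i (p i)))"
    by (simp add: prod.distrib sum_distrib_left lessThan_atLeast0 mult_ac)
  also have "(\<Sum>p\<in>{p. p permutes {0..<N}}. signof p * (\<Prod>i=0..<N. g i (p i))) = det (mat N N (\<lambda>(t, k). g t k))"
    by (subst det_def'[of _ N]) (auto intro!: sum.cong arg_cong2[where f = "(*)"] prod.cong simp: permutes_def)
  finally show ?thesis .
qed

section \<open>Integration of determinants over boxes\<close>

definition uniform01 :: "real measure" where
  "uniform01 = restrict_space lborel {0..1}"

lemma prob_space_uniform01: "prob_space uniform01"
  unfolding uniform01_def by (rule prob_spaceI) (simp add: emeasure_restrict_space space_restrict_space)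

lemma space_uniform01 [simp]: "space uniform01 = {0..1}"
  by (simp add: uniform01_def space_restrict_space)

lemma measurable_uniform01_id [measurable]: "(\<lambda>x. x) \<in> borel_measurable uniform01"
  unfolding uniform01_def by (rule measurable_restrict_space1) simp

interpretation uniform01: prob_space uniform01
  by (rule prob_space_uniform01)

interpretation uniform01s: product_prob_space "\<lambda>_. uniform01" UNIV
  by unfold_locales

lemma has_bochner_integral_uniform01_FTC:
  assumes "0 \<le> a" "a \<le> b" "b \<le> 1"
    and "\<And>x. (F has_real_derivative f x) (at x)" "continuous_on UNIV f"
  shows "has_bochner_integral uniform01 (\<lambda>x. indicator {a..b} x * f x) (F b - F a)"
proof -
  have "has_bochner_integral lborel (\<lambda>x. f x * indicator {a..b} x) (F b - F a)"
    using assms by (intro has_bochner_integral_FTC_Icc_real) (auto simp: continuous_on_eq_continuous_at)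
  also have "(\<lambda>x. f x * indicator {a..b} x) = (\<lambda>x. indicator {0..1} x *\<^sub>R (indicator {a..b} x * f x))"
    using assms by (auto simp: indicator_def fun_eq_iff)
  finally show ?thesis
    unfolding uniform01_def by (subst has_bochner_integral_restrict_space) auto
qed

text \<open>Every term of the Leibniz formula is a product of functions of one coordinate each, so
  its integral is a product of one-dimensional integrals, and these reassemble into a
  determinant.\<close>

lemma has_bochner_integral_box_det:
  assumes "0 \<le> w 0" "w N \<le> 1" "\<And>t. t < N \<Longrightarrow> w t \<le> w (Suc t)"
    and "\<And>k x. k < N \<Longrightarrow> (F k has_real_derivative f k x) (at x)" "\<And>k. k < N \<Longrightarrow> continuous_on UNIV (f k)"
  shows "has_bochner_integral (PiM {..<N} (\<lambda>_. uniform01))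
    (\<lambda>u. (\<Prod>t<N. indicator {w t..w (Suc t)} (u t)) * det (mat N N (\<lambda>(t, k). f k (u t))))
    (det (mat N N (\<lambda>(t, k). F k (w (Suc t)) - F k (w t))))"
proof -
  have w0: "w i \<le> w j" if "i \<le> j" "j \<le> N" for i j
    using that assms(3) by (induction j rule: dec_induct) (auto intro: order.trans)
  have I: "has_bochner_integral uniform01 (\<lambda>x. indicator {w t..w (Suc t)} x * f k x) (F k (w (Suc t)) - F k (w t))"
    if "t < N" "k < N" for t k
    using that assms w0[of 0 t] w0[of "Suc t" N]
    by (intro has_bochner_integral_uniform01_FTC) auto
  have P: "has_bochner_integral (PiM {..<N} (\<lambda>_. uniform01))
    (\<lambda>u. \<Prod>t<N. indicator {w t..w (Suc t)} (u t) * f (p t) (u t))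
    (\<Prod>t<N. F (p t) (w (Suc t)) - F (p t) (w t))" if "p permutes {0..<N}" for p
  proof -
    have p: "p t < N" if "t < N" for t using that \<open>p permutes _\<close> permutes_in_image by fastforce
    show ?thesis
      using I[OF _ p]
      by (auto simp: has_bochner_integral_iff intro!: uniform01s.product_integrable_prod
        uniform01s.product_integral_prod[THEN trans] prod.cong)
  qed
  have "has_bochner_integral (PiM {..<N} (\<lambda>_. uniform01))
    (\<lambda>u. \<Sum>p\<in>{p. p permutes {0..<N}}. signof p * (\<Prod>t<N. indicator {w t..w (Suc t)} (u t) * f (p t) (u t)))
    (\<Sum>p\<in>{p. p permutes {0..<N}}. signof p * (\<Prod>t<N. F (p t) (w (Suc t)) - F (p t) (w t)))"
    by (intro has_bochner_integral_sum has_bochner_integral_mult_right P) auto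
  moreover have "(\<Sum>p\<in>{p. p permutes {0..<N}}. signof p * (\<Prod>t<N. F (p t) (w (Suc t)) - F (p t) (w t)))
    = det (mat N N (\<lambda>(t, k). F k (w (Suc t)) - F k (w t)))"
    by (subst det_def'[of _ N])
       (auto intro!: sum.cong arg_cong2[where f = "(*)"] prod.cong simp: lessThan_atLeast0 permutes_def)
  moreover have "(\<Sum>p\<in>{p. p permutes {0..<N}}. signof p * (\<Prod>t<N. indicator {w t..w (Suc t)} (u t) * f (p t) (u t)))
    = (\<Prod>t<N. indicator {w t..w (Suc t)} (u t)) * det (mat N N (\<lambda>(t, k). f k (u t)))" for u :: "nat \<Rightarrow> real"
    by (subst det_def'[of _ N])
       (auto intro!: sum.cong prod.cong simp: prod.distrib sum_distrib_left mult_ac lessThan_atLeast0 permutes_def)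
  ultimately show ?thesis by simp
qed

text \<open>The freedom in \<open>q\<close> is what matters: the antiderivatives \<open>F k\<close>
  may be chosen to vanish at the bounds 0 and 1, so that the bordered matrix collapses to a
  Vandermonde matrix. The price is the product of leading coefficients.\<close>

lemma has_bochner_integral_box_vandermonde:
  assumes "0 \<le> w 0" "w N \<le> 1" "\<And>t. t < N \<Longrightarrow> w t \<le> w (Suc t)"
    and "\<And>k x. k < N \<Longrightarrow> (F k has_real_derivative \<omega> x * poly (q k) x) (at x)"
    and "continuous_on UNIV \<omega>"
    and "\<And>k. k < N \<Longrightarrow> degree (q k) \<le> k" "\<And>k. k < N \<Longrightarrow> coeff (q k) k \<noteq> 0"
  shows "has_bochner_integral (PiM {..<N} (\<lambda>_. uniform01))
    (\<lambda>u. (\<Prod>t<N. indicator {w t..w (Suc t)} (u t)) * ((\<Prod>t<N. \<omega> (u t)) * vandermonde N u))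
    (det (mat (Suc N) (Suc N) (\<lambda>(t, k). if k = 0 then 1 else F (k - 1) (w t))) / (\<Prod>k<N. coeff (q k) k))"
proof -
  define c where "c = (\<Prod>k<N. coeff (q k) k)"
  have c: "c \<noteq> 0" using assms(7) by (auto simp: c_def)
  have d: "det (mat N N (\<lambda>(t, k). \<omega> (u t) * poly (q k) (u t))) = (\<Prod>t<N. \<omega> (u t)) * (c * vandermonde N u)" for u
    by (simp add: det_scale_rows det_polynomial_columns assms(6) c_def det_vandermonde)
  have "has_bochner_integral (PiM {..<N} (\<lambda>_. uniform01))
    (\<lambda>u. (\<Prod>t<N. indicator {w t..w (Suc t)} (u t)) * det (mat N N (\<lambda>(t, k). \<omega> (u t) * poly (q k) (u t))) / c)
    (det (mat N N (\<lambda>(t, k). F k (w (Suc t)) - F k (w t))) / c)"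
    using assms by (intro has_bochner_integral_divide_zero has_bochner_integral_box_det)
      (auto intro!: continuous_intros)
  then show ?thesis
    unfolding d det_differences c_def[symmetric] using c by (simp add: mult_ac)
qed

lemma DERIV_power_Suc_id: "((\<lambda>x::real. x ^ Suc k) has_real_derivative real (Suc k) * x ^ k) (at x)"
  using DERIV_pow[of "Suc k" x] by simp

lemma DERIV_beta_weight:
  fixes x :: real
  shows "((\<lambda>x. x ^ p * (1 - x) ^ Suc b) has_real_derivative
    (1 - x) ^ b * (real p * x ^ (p - 1) * (1 - x) - real (Suc b) * x ^ p)) (at x)"
proof -
  have 1: "((\<lambda>x. (1 - x) ^ Suc b) has_real_derivative real (Suc b) * (1 - x) ^ b * (- 1)) (at x)"
    by (rule DERIV_chain2[where f = "\<lambda>y. y ^ Suc b" and g = "\<lambda>x. 1 - x", OF DERIV_power_Suc_id])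
       (auto intro!: derivative_eq_intros)
  show ?thesis
    using DERIV_mult[OF DERIV_pow[of p x] 1]
    by (rule back_subst[where P = "\<lambda>d. (_ has_real_derivative d) _"]) (simp add: algebra_simps)
qed

text \<open>With the antiderivatives \<open>x ^ Suc k\<close> the bordered matrix is itself the
  Vandermonde matrix of the bounds; the factors \<open>Suc k\<close> from differentiation multiply
  to \<open>fact N\<close>.\<close>

lemma has_bochner_integral_interlacing_vandermonde:
  assumes "0 \<le> v 0" "v N \<le> 1" "\<And>t. t < N \<Longrightarrow> v t \<le> v (Suc t)"
  shows "has_bochner_integral (PiM {..<N} (\<lambda>_. uniform01))
    (\<lambda>u. (\<Prod>t<N. indicator {v t..v (Suc t)} (u t)) * vandermonde N u) (vandermonde (Suc N) v / fact N)"
proof -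
  define q :: "nat \<Rightarrow> real poly" where "q k = monom (real (Suc k)) k" for k
  have "has_bochner_integral (PiM {..<N} (\<lambda>_. uniform01))
    (\<lambda>u. (\<Prod>t<N. indicator {v t..v (Suc t)} (u t)) * ((\<Prod>t<N. 1) * vandermonde N u))
    (det (mat (Suc N) (Suc N) (\<lambda>(t, k). if k = 0 then 1 else v t ^ Suc (k - 1))) / (\<Prod>k<N. coeff (q k) k))"
    using assms by (intro has_bochner_integral_box_vandermonde[where \<omega> = "\<lambda>_. 1" and F = "\<lambda>k x. x ^ Suc k"])
      (auto simp: q_def poly_monom degree_monom_eq simp del: power_Suc of_nat_Suc intro!: DERIV_power_Suc_id)
  moreover have "mat (Suc N) (Suc N) (\<lambda>(t, k). if k = 0 then 1 else v t ^ Suc (k - 1)) = mat (Suc N) (Suc N) (\<lambda>(t, k). v t ^ k)"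
    by (rule eq_matI) (auto simp: gr0_conv_Suc)
  moreover have "(\<Prod>k<N. coeff (q k) k) = fact N" by (simp add: q_def fact_prod_Suc lessThan_atLeast0)
  ultimately show ?thesis by (simp add: det_vandermonde)
qed

lemma prod_shifted_eq_fact_divide: "(\<Prod>k<N. real (b + 1 + k)) = fact (b + N) / fact b"
  by (induction N) (auto simp: algebra_simps)

text \<open>The antiderivatives \<open>x ^ k * (1 - x) ^ Suc b\<close> vanish at the last bound 1,
  so the last row of the bordered matrix is a unit vector. The sign of its cofactor cancels the
  signs of the leading coefficients.\<close>

lemma has_bochner_integral_interlacing_upper:
  fixes v :: "nat \<Rightarrow> real" and N :: nat
  defines "w \<equiv> \<lambda>t. if t < N then v t else 1"
  assumes "0 \<le> w 0" "\<And>t. t < N \<Longrightarrow> w t \<le> w (Suc t)"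
  shows "has_bochner_integral (PiM {..<N} (\<lambda>_. uniform01))
    (\<lambda>u. (\<Prod>t<N. indicator {w t..w (Suc t)} (u t)) * ((\<Prod>t<N. (1 - u t) ^ b) * vandermonde N u))
    (fact b / fact (b + N) * ((\<Prod>t<N. (1 - v t) ^ Suc b) * vandermonde N v))"
proof -
  define q :: "nat \<Rightarrow> real poly"
    where "q k = monom (real k) (k - 1) - monom (real (b + 1 + k)) k" for k
  define F :: "nat \<Rightarrow> real \<Rightarrow> real" where "F k x = x ^ k * (1 - x) ^ Suc b" for k x
  define B where "B = mat (Suc N) (Suc N) (\<lambda>(t, k). if k = 0 then 1 else F (k - 1) (w t))"
  have deg: "degree (q k) \<le> k" for k
    unfolding q_def by (intro degree_diff_le) (auto intro: order.trans[OF degree_monom_le])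
  have co: "coeff (q k) k = - real (b + 1 + k)" for k by (cases k) (auto simp: q_def)
  have der: "(F k has_real_derivative (1 - x) ^ b * poly (q k) x) (at x)" for k x
    unfolding F_def q_def using DERIV_beta_weight[of k b x]
    by (rule back_subst[where P = "\<lambda>d. (_ has_real_derivative d) _"])
       (cases k; simp add: poly_monom algebra_simps)
  have I: "has_bochner_integral (PiM {..<N} (\<lambda>_. uniform01))
    (\<lambda>u. (\<Prod>t<N. indicator {w t..w (Suc t)} (u t)) * ((\<Prod>t<N. (1 - u t) ^ b) * vandermonde N u))
    (det B / (\<Prod>k<N. coeff (q k) k))"
    unfolding B_def using assms by (intro has_bochner_integral_box_vandermonde der deg)
      (auto simp: co simp del: of_nat_Suc intro!: continuous_intros)
  have "det B = cofactor B N 0"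
    by (subst det_unit_row[of _ N 0 N]) (auto simp: B_def F_def w_def)
  also have "\<dots> = (-1) ^ N * det (mat N N (\<lambda>(t, k). (1 - v t) ^ Suc b * v t ^ k))"
    by (auto simp: cofactor_def mat_delete_def B_def F_def w_def intro!: arg_cong[where f = det] eq_matI)
  also have "\<dots> = (-1) ^ N * ((\<Prod>t<N. (1 - v t) ^ Suc b) * vandermonde N v)"
    by (simp only: det_scale_rows det_vandermonde)
  finally have B: "det B = (-1) ^ N * ((\<Prod>t<N. (1 - v t) ^ Suc b) * vandermonde N v)" .
  have "(\<Prod>k<N. coeff (q k) k) = (-1) ^ N * (fact (b + N) / fact b)"
    unfolding co prod_shifted_eq_fact_divide[symmetric] by (simp only: prod_uminus) simp
  then show ?thesis using I unfolding B by (simp add: mult_ac)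
qed

text \<open>Integration by parts lowers \<open>b\<close> and raises \<open>a\<close>; the value at 1
  is the beta integral.\<close>

lemma incomplete_beta_antiderivative:
  obtains G where "G 0 = 0" "G 1 = fact a * fact b / fact (a + b + 1)"
    "\<And>x::real. (G has_real_derivative x ^ a * (1 - x) ^ b) (at x)"
proof -
  have "\<exists>G. G 0 = 0 \<and> G 1 = fact a * fact b / fact (a + b + 1) \<and>
    (\<forall>x::real. (G has_real_derivative x ^ a * (1 - x) ^ b) (at x))"
  proof (induction b arbitrary: a)
    case 0
    show ?case
      using DERIV_cdivide[OF DERIV_power_Suc_id[of a], of "real (Suc a)"]
      by (intro exI[of _ "\<lambda>x. x ^ Suc a / real (Suc a)"]) (auto simp del: of_nat_Suc power_Suc)
  next
    case (Suc b)
    from Suc[of "Suc a"] obtain G where G: "G 0 = 0" "G 1 = fact (Suc a) * fact b / fact (Suc a + b + 1)"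
      "\<And>x::real. (G has_real_derivative x ^ Suc a * (1 - x) ^ b) (at x)" by auto
    have "((\<lambda>x. (x ^ Suc a * (1 - x) ^ Suc b + real (Suc b) * G x) / real (Suc a)) has_real_derivative
       x ^ a * (1 - x) ^ Suc b) (at x)" for x
      using DERIV_cdivide[OF DERIV_add[OF DERIV_beta_weight[of "Suc a" b x] DERIV_cmult[OF G(3)[of x], of "real (Suc b)"]], of "real (Suc a)"]
      by (rule back_subst[where P = "\<lambda>d. (_ has_real_derivative d) _"]) (simp add: field_simps)
    moreover have "(1 ^ Suc a * (1 - 1) ^ Suc b + real (Suc b) * G 1) / real (Suc a) = fact a * fact (Suc b) / fact (a + Suc b + 1)"
      unfolding G(2) by (simp add: field_simps del: of_nat_Suc)
    ultimately show ?case using G(1)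
      by (intro exI[of _ "\<lambda>x. (x ^ Suc a * (1 - x) ^ Suc b + real (Suc b) * G x) / real (Suc a)"]) auto
  qed
  then show ?thesis using that by blast
qed

text \<open>For \<open>k \<ge> 1\<close> the functions \<open>x ^ (a + k) * (1 - x) ^ Suc b\<close>
  vanish at both 0 and 1. For \<open>k = 0\<close> no antiderivative can, since the weight has
  positive integral; the incomplete beta function \<open>G\<close> takes this place. The first row
  is then a unit vector, and what is left of the last row has the single nonzero entry
  \<open>G 1\<close>.\<close>

lemma has_bochner_integral_interlacing_both:
  fixes v :: "nat \<Rightarrow> real" and r :: nat
  defines "w \<equiv> \<lambda>t. if t = 0 then 0 else if t \<le> r then v (t - 1) else 1"
  assumes "\<And>t. t \<le> r \<Longrightarrow> w t \<le> w (Suc t)"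
  shows "has_bochner_integral (PiM {..<Suc r} (\<lambda>_. uniform01))
    (\<lambda>u. (\<Prod>t<Suc r. indicator {w t..w (Suc t)} (u t)) *
        ((\<Prod>t<Suc r. u t ^ a * (1 - u t) ^ b) * vandermonde (Suc r) u))
    (fact a * fact b / fact (a + b + 1 + r) * ((\<Prod>t<r. v t ^ Suc a * (1 - v t) ^ Suc b) * vandermonde r v))"
proof -
  obtain G where G: "G 0 = 0" "G 1 = fact a * fact b / fact (a + b + 1)"
    "\<And>x::real. (G has_real_derivative x ^ a * (1 - x) ^ b) (at x)"
    using incomplete_beta_antiderivative[of a b] by blast
  define q :: "nat \<Rightarrow> real poly"
    where "q k = (if k = 0 then 1 else monom (real (a + k)) (k - 1) - monom (real (a + b + 1 + k)) k)" for k
  define F :: "nat \<Rightarrow> real \<Rightarrow> real"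
    where "F k x = (if k = 0 then G x else x ^ (a + k) * (1 - x) ^ Suc b)" for k x
  define B where "B = mat (Suc (Suc r)) (Suc (Suc r)) (\<lambda>(t, k). if k = 0 then 1 else F (k - 1) (w t))"
  define C where "C = mat (Suc r) (Suc r) (\<lambda>(t, k). F k (w (Suc t)))"
  have deg: "degree (q k) \<le> k" for k
    unfolding q_def by (auto intro!: degree_diff_le intro: order.trans[OF degree_monom_le])
  have co: "coeff (q k) k = (if k = 0 then 1 else - real (a + b + 1 + k))" for k
    by (cases k) (auto simp: q_def)
  have der: "(F k has_real_derivative (x ^ a * (1 - x) ^ b) * poly (q k) x) (at x)" for k x
  proof (cases k)
    case 0
    then show ?thesis unfolding F_def q_def using G(3)[of x] by simp
  next
    case (Suc j)
    have "((\<lambda>x. x ^ (a + k) * (1 - x) ^ Suc b) has_real_derivative (x ^ a * (1 - x) ^ b) * poly (q k) x) (at x)"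
      using DERIV_beta_weight[of "a + k" b x]
      by (rule back_subst[where P = "\<lambda>d. (_ has_real_derivative d) _"])
         (simp add: Suc q_def poly_monom algebra_simps power_add)
    then show ?thesis by (simp add: F_def[abs_def] Suc)
  qed
  have I: "has_bochner_integral (PiM {..<Suc r} (\<lambda>_. uniform01))
    (\<lambda>u. (\<Prod>t<Suc r. indicator {w t..w (Suc t)} (u t)) *
        ((\<Prod>t<Suc r. u t ^ a * (1 - u t) ^ b) * vandermonde (Suc r) u))
    (det B / (\<Prod>k<Suc r. coeff (q k) k))"
    unfolding B_def using assms by (intro has_bochner_integral_box_vandermonde der deg)
      (auto simp: co simp del: of_nat_Suc intro!: continuous_intros)
  have "det B = cofactor B 0 0"
    by (subst det_unit_row[of _ "Suc r" 0 0]) (auto simp: B_def F_def w_def G)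
  also have "\<dots> = det C"
    by (auto simp: cofactor_def mat_delete_def B_def C_def intro!: arg_cong[where f = det] eq_matI)
  also have "\<dots> = G 1 * cofactor C r 0"
    by (subst det_unit_row[of _ r 0 r]) (auto simp: C_def F_def w_def)
  also have "cofactor C r 0 = (-1) ^ r * det (mat r r (\<lambda>(t, k). (v t ^ Suc a * (1 - v t) ^ Suc b) * v t ^ k))"
    by (auto simp: cofactor_def mat_delete_def C_def F_def w_def power_add intro!: arg_cong[where f = det] eq_matI)
  also have "\<dots> = (-1) ^ r * ((\<Prod>t<r. v t ^ Suc a * (1 - v t) ^ Suc b) * vandermonde r v)"
    by (simp only: det_scale_rows det_vandermonde)
  finally have B: "det B = fact a * fact b / fact (a + b + 1) * ((-1) ^ r * ((\<Prod>t<r. v t ^ Suc a * (1 - v t) ^ Suc b) * vandermonde r v))"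
    unfolding G .
  \<comment> \<open>The column of \<open>G\<close> has leading coefficient 1. The other coefficients
    give a quotient of factorials whose lower part cancels against the denominator of
    \<open>G 1\<close>.\<close>
  have "(\<Prod>k<Suc r. coeff (q k) k) = (\<Prod>k<r. - real (a + b + 1 + 1 + k))"
    unfolding co by (subst prod.lessThan_Suc_shift) simp
  also have "\<dots> = (-1) ^ r * (fact (a + b + 1 + r) / fact (a + b + 1))"
    unfolding prod_shifted_eq_fact_divide[symmetric] by (simp only: prod_uminus) simp
  finally show ?thesis using I unfolding B by (simp add: mult_ac)
qed

subsection \<open>Tableaux and volumes of order polytopes\<close>

abbreviation cube :: "'i set \<Rightarrow> ('i \<Rightarrow> real) measure" where
  "cube I \<equiv> PiM I (\<lambda>_. uniform01)"

lemma prob_space_cube: "prob_space (cube I)"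
  by (intro prob_space_PiM prob_space_uniform01)

lemma measurable_cube_component: "i \<in> I \<Longrightarrow> (\<lambda>u. u i) \<in> borel_measurable (cube I)"
  using measurable_compose[OF measurable_component_singleton[of i I "\<lambda>_. uniform01"], of "\<lambda>x. x" borel]
  by simp

lemma in_space_cube: "u \<in> space (cube I) \<Longrightarrow> i \<in> I \<Longrightarrow> u i \<in> {0..1}"
  by (auto simp: space_PiM PiE_def Pi_def)

lemma distr_cube_reindex:
  assumes "inj_on f I" "f ` I \<subseteq> K"
  shows "distr (cube K) (cube I) (\<lambda>\<omega>. \<lambda>i\<in>I. \<omega> (f i)) = cube I"
  using assms by (intro distr_PiM_reindex prob_space_uniform01) auto

lemma measurable_cube_reindex:
  assumes "f ` I \<subseteq> K"
  shows "(\<lambda>\<omega>. \<lambda>i\<in>I. \<omega> (f i)) \<in> measurable (cube K) (cube I)"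
  using assms by (intro measurable_restrict measurable_component_singleton) auto

text \<open>With coordinate \<open>i\<close> integrated first, each slice of the set of ties is at
  most one point.\<close>

lemma AE_cube_distinct:
  assumes "finite I" "i \<in> I" "j \<in> I" "i \<noteq> j"
  shows "AE u in cube I. u i \<noteq> u j"
proof -
  define J where "J = I - {i}"
  have J: "I = insert i J" "finite J" "i \<notin> J" "j \<in> J" using assms by (auto simp: J_def)
  have m: "(\<lambda>u. u i) \<in> borel_measurable (cube I)" "(\<lambda>u. u j) \<in> borel_measurable (cube I)"
    using assms by (auto intro: measurable_cube_component)
  define S where "S = {u \<in> space (cube I). u i = u j}"
  have S: "S \<in> sets (cube I)" unfolding S_def by (rule borel_measurable_eq[OF m])
  have "emeasure (cube I) S = (\<integral>\<^sup>+u. indicator S u \<partial>cube (insert i J))"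
    using S J(1) by simp
  also have "\<dots> = (\<integral>\<^sup>+u. (\<integral>\<^sup>+y. indicator S (u(i := y)) \<partial>uniform01) \<partial>cube J)"
    using J S by (intro uniform01s.product_nn_integral_insert) auto
  also have "\<dots> = (\<integral>\<^sup>+u. 0 \<partial>cube J)"
  proof (rule nn_integral_cong)
    fix u :: "'a \<Rightarrow> real"
    have "(\<integral>\<^sup>+y. indicator S (u(i := y)) \<partial>uniform01) \<le> (\<integral>\<^sup>+y. indicator {u j} y \<partial>lborel)"
    proof -
      have "(\<integral>\<^sup>+y. indicator S (u(i := y)) \<partial>uniform01) = (\<integral>\<^sup>+y. indicator S (u(i := y)) * indicator {0..1} y \<partial>lborel)"
        unfolding uniform01_def by (subst nn_integral_restrict_space) auto
      also have "\<dots> \<le> (\<integral>\<^sup>+y. indicator {u j} y \<partial>lborel)"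
        using assms(4) by (intro nn_integral_mono) (simp add: S_def indicator_def split: if_splits)
      finally show ?thesis .
    qed
    also have "\<dots> = 0" by (subst nn_integral_indicator) auto
    finally show "(\<integral>\<^sup>+y. indicator S (u(i := y)) \<partial>uniform01) = 0" by simp
  qed
  finally have "emeasure (cube I) S = 0" by simp
  then show ?thesis using S by (intro AE_I[of _ _ S]) (auto simp: S_def)
qed

lemma AE_cube_inj_on:
  assumes "finite I"
  shows "AE u in cube I. inj_on u I"
proof -
  have "AE u in cube I. \<forall>i\<in>I. \<forall>j\<in>I. i \<noteq> j \<longrightarrow> u i \<noteq> u j"
    using assms by (auto simp: AE_finite_all intro: AE_cube_distinct)
  then show ?thesis by eventually_elim (auto simp: inj_on_def)
qed

lemma sets_Collect_Ball_cube:
  assumes "finite D" "\<And>a b. a \<in> D \<Longrightarrow> b \<in> D \<Longrightarrow> P a b \<Longrightarrow> {u \<in> space (cube I). Q a b u} \<in> sets (cube I)"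
  shows "{u \<in> space (cube I). \<forall>a\<in>D. \<forall>b\<in>D. P a b \<longrightarrow> Q a b u} \<in> sets (cube I)"
proof -
  have "{u \<in> space (cube I). P a b \<longrightarrow> Q a b u} \<in> sets (cube I)" if "a \<in> D" "b \<in> D" for a b
    using assms(2)[OF that] by (cases "P a b") auto
  then show ?thesis using assms(1) by (intro sets.sets_Collect_finite_All) auto
qed

section \<open>Cutting the cube into simplices of equal volume\<close>

definition rankings :: "'a set \<Rightarrow> ('a \<Rightarrow> nat) set" where
  "rankings D = {\<tau> \<in> extensional D. bij_betw \<tau> D {1..card D}}"

definition ranking_cell :: "'a set \<Rightarrow> ('a \<Rightarrow> nat) \<Rightarrow> ('a \<Rightarrow> real) set" where
  "ranking_cell D \<tau> = {u \<in> space (cube D). \<forall>a\<in>D. \<forall>b\<in>D. \<tau> a < \<tau> b \<longrightarrow> u a < u b}"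

lemma card_rankings:
  assumes "finite D"
  shows "finite (rankings D)" "card (rankings D) = fact (card D)"
proof -
  have "rankings D = {\<tau> \<in> D \<rightarrow>\<^sub>E {1..card D}. inj_on \<tau> D}"
  proof -
    have "\<tau> ` D = {1..card D}" if "\<tau> ` D \<subseteq> {1..card D}" "inj_on \<tau> D" for \<tau> :: "'a \<Rightarrow> nat"
      using that by (intro card_subset_eq) (auto simp: card_image)
    then show ?thesis by (auto simp: rankings_def bij_betw_def PiE_def image_subset_iff_funcset)
  qed
  then show "finite (rankings D)" "card (rankings D) = fact (card D)"
    using assms card_inj_on_subset_funcset[of D "{1..card D}" D]
    by (auto simp: fact_prod_rev finite_PiE)
qed

lemma sets_ranking_cell:
  assumes "finite D"
  shows "ranking_cell D \<tau> \<in> sets (cube D)"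
  unfolding ranking_cell_def using assms
  by (intro sets_Collect_Ball_cube) (auto intro: borel_measurable_less measurable_cube_component)

text \<open>Relabelling the coordinates along \<open>\<tau>\<close> preserves the product measure
  and carries the cell to the standard simplex, so all cells share a volume that need not be
  computed here.\<close>

lemma measure_ranking_cell_eq:
  assumes "finite D" "\<tau> \<in> rankings D"
  shows "measure (cube D) (ranking_cell D \<tau>) =
    measure (cube {1..card D}) (ranking_cell {1..card D} (\<lambda>i. i))"
proof -
  let ?N = "{1..card D}"
  have bij: "bij_betw \<tau> D ?N" using assms by (simp add: rankings_def)
  let ?f = "\<lambda>\<omega>. \<lambda>i\<in>D. \<omega> (\<tau> i)"
  have "measure (cube D) (ranking_cell D \<tau>) = measure (distr (cube ?N) (cube D) ?f) (ranking_cell D \<tau>)"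
    using bij by (subst distr_cube_reindex) (auto simp: bij_betw_def)
  also have "\<dots> = measure (cube ?N) (?f -` ranking_cell D \<tau> \<inter> space (cube ?N))"
    using bij assms by (intro measure_distr measurable_cube_reindex sets_ranking_cell) (auto simp: bij_betw_def)
  also have "?f -` ranking_cell D \<tau> \<inter> space (cube ?N) = ranking_cell ?N (\<lambda>i. i)"
  proof -
    have "?f u \<in> space (cube D)" if "u \<in> space (cube ?N)" for u
      using measurable_space[OF measurable_cube_reindex[of \<tau> D ?N] that] bij by (auto simp: bij_betw_def)
    moreover have "(\<forall>a\<in>D. \<forall>b\<in>D. P (\<tau> a) (\<tau> b)) \<longleftrightarrow> (\<forall>a\<in>?N. \<forall>b\<in>?N. P a b)" for P
      unfolding bij_betw_imp_surj_on[OF bij, symmetric] by blast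
    note this[of "\<lambda>a b. a < b \<longrightarrow> u a < u b" for u]
    ultimately show ?thesis by (auto simp: ranking_cell_def)
  qed
  finally show ?thesis .
qed

lemma ranking_cell_cong:
  assumes "u \<in> ranking_cell D \<tau>" "\<tau> \<in> rankings D" "a \<in> D" "b \<in> D"
  shows "u a < u b \<longleftrightarrow> \<tau> a < \<tau> b"
proof -
  have "\<tau> a = \<tau> b \<longleftrightarrow> a = b" using assms by (auto simp: rankings_def bij_betw_def inj_on_def)
  moreover have "\<forall>a\<in>D. \<forall>b\<in>D. \<tau> a < \<tau> b \<longrightarrow> u a < u b" using assms by (simp add: ranking_cell_def)
  ultimately show ?thesis using assms(3,4) by (metis less_asym linorder_neqE)
qed

text \<open>A ranking is recovered from the order it induces: its value at \<open>a\<close> is one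
  more than the number of elements ranked below \<open>a\<close>.\<close>

lemma rankings_eqI:
  assumes "\<tau> \<in> rankings D" "\<sigma> \<in> rankings D" "finite D"
    "\<And>a b. a \<in> D \<Longrightarrow> b \<in> D \<Longrightarrow> \<tau> a < \<tau> b \<longleftrightarrow> \<sigma> a < \<sigma> b"
  shows "\<tau> = \<sigma>"
proof (rule extensionalityI)
  show "\<tau> \<in> extensional D" "\<sigma> \<in> extensional D" using assms by (auto simp: rankings_def)
  fix a assume a: "a \<in> D"
  have r: "card {b \<in> D. \<rho> b < \<rho> a} = \<rho> a - 1" if "\<rho> \<in> rankings D" for \<rho>
  proof -
    have bij: "bij_betw \<rho> D {1..card D}" using that by (simp add: rankings_def)
    then have "\<rho> a \<in> {1..card D}" using a by (auto simp: bij_betw_def)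
    then have "\<rho> ` {b \<in> D. \<rho> b < \<rho> a} = {1..<\<rho> a}"
      using bij_betw_imp_surj_on[OF bij] by (fastforce simp: image_iff)
    moreover have "inj_on \<rho> {b \<in> D. \<rho> b < \<rho> a}"
      using bij by (auto simp: bij_betw_def intro: inj_on_subset)
    ultimately show ?thesis using card_image by fastforce
  qed
  have "\<tau> a \<ge> 1" "\<sigma> a \<ge> 1" using a assms(1,2) by (auto simp: rankings_def bij_betw_def)
  moreover have "{b \<in> D. \<tau> b < \<tau> a} = {b \<in> D. \<sigma> b < \<sigma> a}" using assms(4) a by auto
  ultimately show "\<tau> a = \<sigma> a" using r[OF assms(1)] r[OF assms(2)] by simp
qed

lemma disjoint_ranking_cells:
  assumes "finite D"
  shows "disjoint_family_on (ranking_cell D) (rankings D)"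
proof (unfold disjoint_family_on_def, intro ballI impI, rule ccontr)
  fix \<tau> \<sigma> assume *: "\<tau> \<in> rankings D" "\<sigma> \<in> rankings D" "\<tau> \<noteq> \<sigma>"
    "ranking_cell D \<tau> \<inter> ranking_cell D \<sigma> \<noteq> {}"
  then obtain u where "u \<in> ranking_cell D \<tau>" "u \<in> ranking_cell D \<sigma>" by blast
  with * have "\<tau> = \<sigma>"
    using ranking_cell_cong[of u D \<tau>] ranking_cell_cong[of u D \<sigma>] by (intro rankings_eqI[OF _ _ assms]) auto
  with * show False by simp
qed

text \<open>The ranking counts, for each \<open>a\<close>, the coordinates that are at most
  \<open>u a\<close>.\<close>

lemma inj_on_imp_ranking_cell:
  assumes "finite D" "u \<in> space (cube D)" "inj_on u D"
  obtains \<tau> where "\<tau> \<in> rankings D" "u \<in> ranking_cell D \<tau>"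
proof -
  define \<tau> where "\<tau> = (\<lambda>a\<in>D. card {b \<in> D. u b \<le> u a})"
  have mono: "\<tau> a < \<tau> b" if "a \<in> D" "b \<in> D" "u a < u b" for a b
  proof -
    have "b \<notin> {c \<in> D. u c \<le> u a}" "b \<in> {c \<in> D. u c \<le> u b}" using that by auto
    then have "{c \<in> D. u c \<le> u a} \<subset> {c \<in> D. u c \<le> u b}" using that by fastforce
    then show ?thesis using that assms(1) by (simp add: \<tau>_def psubset_card_mono)
  qed
  have inj: "inj_on \<tau> D"
  proof (rule inj_onI)
    fix a b assume ab: "a \<in> D" "b \<in> D" "\<tau> a = \<tau> b"
    then have "u a = u b" using mono[of a b] mono[of b a] by (cases "u a" "u b" rule: linorder_cases) auto
    then show "a = b" using assms(3) ab by (simp add: inj_on_def)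
  qed
  have "\<tau> ` D \<subseteq> {1..card D}"
  proof safe
    fix a assume a: "a \<in> D"
    then have "card {b \<in> D. u b \<le> u a} > 0" using assms(1) by (auto simp: card_gt_0_iff)
    then show "\<tau> a \<in> {1..card D}" using a assms(1) by (auto simp: \<tau>_def intro!: card_mono)
  qed
  then have "bij_betw \<tau> D {1..card D}"
    using inj card_subset_eq[of "{1..card D}" "\<tau> ` D"] by (auto simp: bij_betw_def card_image)
  then have "\<tau> \<in> rankings D" by (simp add: rankings_def \<tau>_def)
  moreover have "u \<in> ranking_cell D \<tau>"
  proof -
    have "u a < u b" if "a \<in> D" "b \<in> D" "\<tau> a < \<tau> b" for a b
    proof (rule ccontr)
      assume "\<not> u a < u b"
      then consider "u b < u a" | "u a = u b" by linarith
      then show False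
        using that mono[of b a] assms(3) by cases (auto simp: inj_on_def)
    qed
    then show ?thesis using assms(2) by (simp add: ranking_cell_def)
  qed
  ultimately show ?thesis using that by blast
qed

text \<open>The cells are disjoint and of equal measure, and together they miss only the null set of
  ties; taking all rankings gives each cell the measure \<open>1 / fact (card D)\<close>.\<close>

lemma measure_Union_ranking_cells:
  assumes "finite D" "S \<subseteq> rankings D"
  shows "measure (cube D) (\<Union>\<tau>\<in>S. ranking_cell D \<tau>) = real (card S) / fact (card D)"
proof -
  interpret prob_space "cube D" by (rule prob_space_cube)
  define q where "q = measure (cube {1..card D}) (ranking_cell {1..card D} (\<lambda>i. i))"
  have U: "prob (\<Union>\<tau>\<in>S. ranking_cell D \<tau>) = real (card S) * q" if "S \<subseteq> rankings D" for S
  proof -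
    have "prob (\<Union>\<tau>\<in>S. ranking_cell D \<tau>) = (\<Sum>\<tau>\<in>S. prob (ranking_cell D \<tau>))"
      using that assms(1) card_rankings(1)[OF assms(1)] disjoint_ranking_cells[OF assms(1)]
      by (intro finite_measure_finite_Union) (auto intro: finite_subset disjoint_family_on_mono sets_ranking_cell)
    also have "\<dots> = (\<Sum>\<tau>\<in>S. q)"
      using that assms(1) unfolding q_def by (intro sum.cong measure_ranking_cell_eq) auto
    finally show ?thesis by simp
  qed
  have "prob (\<Union>\<tau>\<in>rankings D. ranking_cell D \<tau>) = 1"
  proof (rule prob_eq_1[THEN iffD2])
    show "(\<Union>\<tau>\<in>rankings D. ranking_cell D \<tau>) \<in> events"
      using assms(1) card_rankings(1) by (intro sets.finite_UN sets_ranking_cell) auto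
    show "AE u in cube D. u \<in> (\<Union>\<tau>\<in>rankings D. ranking_cell D \<tau>)"
      using AE_cube_inj_on[OF assms(1)] AE_space
    proof eventually_elim
      case (elim u)
      then show ?case using inj_on_imp_ranking_cell[OF assms(1), of u] by blast
    qed
  qed
  then have "fact (card D) * q = 1" using U[of "rankings D"] card_rankings[OF assms(1)] by simp
  then show ?thesis using U[OF assms(2)] by (simp add: field_simps)
qed

text \<open>Off the ties a point lies in exactly one cell, and its ranking alone decides whether it
  satisfies the constraints. \<open>R\<close> is only required to be irreflexive, so row and column
  comparisons enter without a transitive closure.\<close>

lemma measure_order_polytope:
  assumes "finite D" "\<And>a. (a, a) \<notin> R"
  shows "measure (cube D) {u \<in> space (cube D). \<forall>a\<in>D. \<forall>b\<in>D. (a, b) \<in> R \<longrightarrow> u a \<le> u b} =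
    real (card {\<tau> \<in> rankings D. \<forall>a\<in>D. \<forall>b\<in>D. (a, b) \<in> R \<longrightarrow> \<tau> a < \<tau> b}) / fact (card D)"
    (is "measure _ ?O = real (card ?S) / _")
proof -
  have "measure (cube D) ?O = measure (cube D) (\<Union>\<tau>\<in>?S. ranking_cell D \<tau>)"
  proof (rule measure_eq_AE)
    show "?O \<in> sets (cube D)"
      using assms by (intro sets_Collect_Ball_cube) (auto intro: borel_measurable_le measurable_cube_component)
    show "(\<Union>\<tau>\<in>?S. ranking_cell D \<tau>) \<in> sets (cube D)"
      using assms(1) card_rankings(1)[OF assms(1)]
      by (intro sets.finite_UN sets_ranking_cell) simp_all
    show "AE u in cube D. u \<in> ?O \<longleftrightarrow> u \<in> (\<Union>\<tau>\<in>?S. ranking_cell D \<tau>)"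
      using AE_cube_inj_on[OF assms(1)] AE_space
    proof eventually_elim
      case (elim u)
      obtain \<tau> where t: "\<tau> \<in> rankings D" "u \<in> ranking_cell D \<tau>"
        using inj_on_imp_ranking_cell[OF assms(1) elim(2,1)] .
      have *: "\<sigma> = \<tau>" if "\<sigma> \<in> rankings D" "u \<in> ranking_cell D \<sigma>" for \<sigma>
        using disjoint_ranking_cells[OF assms(1)] that t by (auto simp: disjoint_family_on_def)
      have "u a \<le> u b \<longleftrightarrow> \<tau> a < \<tau> b" if "a \<in> D" "b \<in> D" "(a, b) \<in> R" for a b
      proof -
        have "a \<noteq> b" using that assms(2) by blast
        then have "u a \<noteq> u b" using that elim(1) by (auto simp: inj_on_def)
        then show ?thesis using ranking_cell_cong[OF t(2,1) that(1,2)] by auto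
      qed
      then have "u \<in> ?O \<longleftrightarrow> \<tau> \<in> ?S" using elim(2) t(1) by auto
      also have "\<dots> \<longleftrightarrow> u \<in> (\<Union>\<tau>\<in>?S. ranking_cell D \<tau>)"
      proof
        assume "u \<in> (\<Union>\<tau>\<in>?S. ranking_cell D \<tau>)"
        then obtain \<sigma> where \<sigma>: "\<sigma> \<in> ?S" "u \<in> ranking_cell D \<sigma>" by blast
        then have "\<sigma> = \<tau>" using * by blast
        then show "\<tau> \<in> ?S" using \<sigma>(1) by simp
      qed (use t(2) in blast)
      finally show ?case .
    qed
  qed
  also have "\<dots> = real (card ?S) / fact (card D)"
    using assms(1) by (rule measure_Union_ranking_cells) auto
  finally show ?thesis .
qed

text \<open>Strict and weak inequalities cut out sets of the same measure; the weak ones give closed boxes.\<close>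

definition weakly_increasing :: "diagram \<Rightarrow> (nat \<times> nat \<Rightarrow> real) \<Rightarrow> bool" where
  "weakly_increasing D T \<longleftrightarrow>
     (\<forall>i j j'. (i, j) \<in> D \<longrightarrow> (i, j') \<in> D \<longrightarrow> j < j' \<longrightarrow> T (i, j) \<le> T (i, j')) \<and>
     (\<forall>i i' j. (i, j) \<in> D \<longrightarrow> (i', j) \<in> D \<longrightarrow> i < i' \<longrightarrow> T (i, j) \<le> T (i', j))"

lemma num_syt_eq_measure:
  assumes "finite D"
  shows "real (num_syt D) = fact (card D) * measure (cube D) {T \<in> space (cube D). weakly_increasing D T}"
proof -
  define R :: "((nat \<times> nat) \<times> (nat \<times> nat)) set"
    where "R = {((i, j), (i', j')). i = i' \<and> j < j' \<or> i < i' \<and> j = j'}"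
  have R: "(\<forall>a\<in>D. \<forall>b\<in>D. (a, b) \<in> R \<longrightarrow> P a b) \<longleftrightarrow>
     (\<forall>i j j'. (i, j) \<in> D \<longrightarrow> (i, j') \<in> D \<longrightarrow> j < j' \<longrightarrow> P (i, j) (i, j')) \<and>
     (\<forall>i i' j. (i, j) \<in> D \<longrightarrow> (i', j) \<in> D \<longrightarrow> i < i' \<longrightarrow> P (i, j) (i', j))" for P
    unfolding R_def by (simp only: Ball_def split_paired_All mem_Collect_eq split_conv) blast
  have "standard_tableaux D = {\<tau> \<in> rankings D. \<forall>a\<in>D. \<forall>b\<in>D. (a, b) \<in> R \<longrightarrow> \<tau> a < \<tau> b}"
    unfolding standard_tableaux_def rankings_def R by blast
  moreover have "(\<forall>a\<in>D. \<forall>b\<in>D. (a, b) \<in> R \<longrightarrow> T a \<le> T b) \<longleftrightarrow> weakly_increasing D T" for T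
    unfolding weakly_increasing_def R by blast
  moreover have "(a, a) \<notin> R" for a by (auto simp: R_def)
  ultimately show ?thesis
    using measure_order_polytope[OF assms, of R] by (simp add: num_syt_def)
qed

subsection \<open>Aomoto's recurrence\<close>

definition subsets_of_card :: "nat set \<Rightarrow> nat \<Rightarrow> nat set set" where
  "subsets_of_card S k = {K. K \<subseteq> S \<and> card K = k}"

definition elem_sym :: "nat set \<Rightarrow> nat \<Rightarrow> (nat \<Rightarrow> real) \<Rightarrow> real" where
  "elem_sym S k u = (\<Sum>K\<in>subsets_of_card S k. \<Prod>l\<in>K. u l)"

lemma finite_subsets_of_card: "finite S \<Longrightarrow> finite (subsets_of_card S k)"
  by (auto simp: subsets_of_card_def)

text \<open>Double counting: a pair of a set and one of its elements corresponds to a smaller set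
  and an element outside it.\<close>

lemma sum_subsets_of_card_Suc:
  fixes f :: "nat set \<Rightarrow> nat \<Rightarrow> real"
  assumes "finite S"
  shows "(\<Sum>K\<in>subsets_of_card S (Suc k). \<Sum>i\<in>K. f (K - {i}) i) = (\<Sum>L\<in>subsets_of_card S k. \<Sum>i\<in>S - L. f L i)"
proof -
  have fin: "finite K" if "K \<in> subsets_of_card S k" for K k
    using that assms by (auto simp: subsets_of_card_def intro: finite_subset)
  have "(\<Sum>K\<in>subsets_of_card S (Suc k). \<Sum>i\<in>K. f (K - {i}) i) =
      (\<Sum>(K, i)\<in>Sigma (subsets_of_card S (Suc k)) (\<lambda>K. K). f (K - {i}) i)"
    using fin finite_subsets_of_card[OF assms] by (intro sum.Sigma) auto
  also have "\<dots> = (\<Sum>(L, i)\<in>Sigma (subsets_of_card S k) (\<lambda>L. S - L). f L i)"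
    using fin
    by (intro sum.reindex_bij_witness[of _ "\<lambda>(L, i). (insert i L, i)" "\<lambda>(K, i). (K - {i}, i)"])
       (auto simp: subsets_of_card_def card_insert_if insert_absorb)
  also have "\<dots> = (\<Sum>L\<in>subsets_of_card S k. \<Sum>i\<in>S - L. f L i)"
    using assms finite_subsets_of_card[OF assms] by (intro sum.Sigma[symmetric]) auto
  finally show ?thesis .
qed

lemma sum_pairs_symmetrize:
  fixes f :: "nat \<Rightarrow> nat \<Rightarrow> real"
  assumes "finite K"
  shows "(\<Sum>i\<in>K. \<Sum>j\<in>K - {i}. f i j) = (\<Sum>i\<in>K. \<Sum>j\<in>K - {i}. (f i j + f j i) / 2)"
proof -
  have "(\<Sum>i\<in>K. \<Sum>j\<in>K - {i}. g i j) = (\<Sum>i\<in>K. \<Sum>j\<in>K. if i = j then 0 else g i j)" for g :: "nat \<Rightarrow> nat \<Rightarrow> real"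
    using assms by (intro sum.cong sum.mono_neutral_cong_left) auto
  note * = this
  have "(\<Sum>i\<in>K. \<Sum>j\<in>K. if i = j then 0 else f j i) = (\<Sum>i\<in>K. \<Sum>j\<in>K. if i = j then 0 else f i j)"
    by (subst sum.swap) (auto intro!: sum.cong)
  then have "(\<Sum>i\<in>K. \<Sum>j\<in>K - {i}. f j i) = (\<Sum>i\<in>K. \<Sum>j\<in>K - {i}. f i j)"
    using *[of "\<lambda>i j. f j i"] *[of f] by simp
  then show ?thesis by (simp add: sum.distrib sum_divide_distrib[symmetric])
qed

text \<open>\<open>D i j\<close> plays the role of \<open>\<Phi> / (u i - u j)\<close>, stated by
  multiplication so that coinciding points are allowed. Since \<open>D\<close> is antisymmetric,
  averaging over both orders of a pair makes the difference \<open>u i - u j\<close> appear as a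
  factor, and the quotient disappears.\<close>

lemma Aomoto_identity:
  fixes u :: "nat \<Rightarrow> real" and D :: "nat \<Rightarrow> nat \<Rightarrow> real" and \<alpha> \<beta> :: real
  assumes "finite S" "card S = r" "k < r"
    and anti: "\<And>i j. i \<in> S \<Longrightarrow> j \<in> S \<Longrightarrow> i \<noteq> j \<Longrightarrow> D j i = - D i j"
    and D: "\<And>i j. i \<in> S \<Longrightarrow> j \<in> S \<Longrightarrow> i \<noteq> j \<Longrightarrow> D i j * (u i - u j) = \<Phi>"
  defines "X \<equiv> \<lambda>K. \<Prod>l\<in>K. u l"
  shows "(\<Sum>K\<in>subsets_of_card S (Suc k). \<Sum>i\<in>K. \<alpha> * X (K - {i}) * \<Phi> - \<beta> * X K * \<Phi> + (\<Sum>j\<in>S - {i}. (1 - u i) * X K * D i j))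
    = (real (r - k) * \<alpha> + real (r - k) * real (r - Suc k) / 2) * elem_sym S k u * \<Phi>
    - real (Suc k) * (\<beta> + real k / 2 + real (r - Suc k)) * elem_sym S (Suc k) u * \<Phi>"
proof -
  have fin: "finite K" and card: "card K = k" and sub: "K \<subseteq> S" if "K \<in> subsets_of_card S k" for K k
    using that assms(1) by (auto simp: subsets_of_card_def intro: finite_subset)
  have cardc: "card (S - L) = r - k" if "L \<in> subsets_of_card S k" for L
    using fin[OF that] sub[OF that] card[OF that] assms(2) by (simp add: card_Diff_subset)
  have X: "X K = u i * X (K - {i})" if "finite K" "i \<in> K" for K i
    using that by (simp add: X_def prod.remove)
  have esum: "(\<Sum>L\<in>subsets_of_card S k. X L) = elem_sym S k u" for k by (simp add: elem_sym_def X_def)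
  have Xu: "(\<Sum>L\<in>subsets_of_card S k. X L * (\<Sum>i\<in>S - L. u i)) = real (Suc k) * elem_sym S (Suc k) u"
  proof -
    have "(\<Sum>L\<in>subsets_of_card S k. X L * (\<Sum>i\<in>S - L. u i)) =
       (\<Sum>K\<in>subsets_of_card S (Suc k). \<Sum>i\<in>K. X (K - {i}) * u i)"
      using sum_subsets_of_card_Suc[OF assms(1), of "\<lambda>L i. X L * u i" k] by (simp add: sum_distrib_left)
    also have "\<dots> = (\<Sum>K\<in>subsets_of_card S (Suc k). \<Sum>i\<in>K. X K)"
      using fin by (intro sum.cong refl) (metis X mult.commute)
    also have "\<dots> = (\<Sum>K\<in>subsets_of_card S (Suc k). real (Suc k) * X K)"
      by (intro sum.cong refl) (simp add: card)
    finally show ?thesis by (simp add: sum_distrib_left[symmetric] esum)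
  qed
  have T1: "(\<Sum>K\<in>subsets_of_card S (Suc k). \<Sum>i\<in>K. \<alpha> * X (K - {i}) * \<Phi>) = real (r - k) * \<alpha> * elem_sym S k u * \<Phi>"
  proof -
    have "(\<Sum>K\<in>subsets_of_card S (Suc k). \<Sum>i\<in>K. \<alpha> * X (K - {i}) * \<Phi>) =
      (\<Sum>L\<in>subsets_of_card S k. \<Sum>i\<in>S - L. \<alpha> * X L * \<Phi>)"
      using sum_subsets_of_card_Suc[OF assms(1), of "\<lambda>L i. \<alpha> * X L * \<Phi>"] by simp
    also have "\<dots> = (\<Sum>L\<in>subsets_of_card S k. real (r - k) * \<alpha> * \<Phi> * X L)"
      by (intro sum.cong refl) (simp add: cardc)
    finally show ?thesis by (simp add: sum_distrib_left[symmetric] esum)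
  qed
  have T2: "(\<Sum>K\<in>subsets_of_card S (Suc k). \<Sum>i\<in>K. \<beta> * X K * \<Phi>) = real (Suc k) * \<beta> * elem_sym S (Suc k) u * \<Phi>"
  proof -
    have "(\<Sum>K\<in>subsets_of_card S (Suc k). \<Sum>i\<in>K. \<beta> * X K * \<Phi>) = (\<Sum>K\<in>subsets_of_card S (Suc k). real (Suc k) * \<beta> * \<Phi> * X K)"
      by (intro sum.cong refl) (simp add: card)
    then show ?thesis by (simp add: sum_distrib_left[symmetric] esum)
  qed
  \<comment> \<open>Both indices in \<open>K\<close>: the average contains
    \<open>(1 - u i) - (1 - u j)\<close>, so each ordered pair yields
    \<open>- X K * \<Phi> / 2\<close>.\<close>
  have Ta: "(\<Sum>K\<in>subsets_of_card S (Suc k). \<Sum>i\<in>K. \<Sum>j\<in>K - {i}. (1 - u i) * X K * D i j)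
     = - (real (Suc k) * real k / 2) * elem_sym S (Suc k) u * \<Phi>"
  proof -
    have "(\<Sum>i\<in>K. \<Sum>j\<in>K - {i}. (1 - u i) * X K * D i j) = - (real (Suc k) * real k / 2) * \<Phi> * X K"
      if K: "K \<in> subsets_of_card S (Suc k)" for K
    proof -
      have "(\<Sum>i\<in>K. \<Sum>j\<in>K - {i}. (1 - u i) * X K * D i j) =
         (\<Sum>i\<in>K. \<Sum>j\<in>K - {i}. ((1 - u i) * X K * D i j + (1 - u j) * X K * D j i) / 2)"
        by (rule sum_pairs_symmetrize[OF fin[OF K]])
      also have "\<dots> = (\<Sum>i\<in>K. \<Sum>j\<in>K - {i}. - (X K * \<Phi> / 2))"
      proof (intro sum.cong refl)
        fix i j assume "i \<in> K" "j \<in> K - {i}"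
        then have ij: "i \<in> S" "j \<in> S" "i \<noteq> j" using sub[OF K] by auto
        show "((1 - u i) * X K * D i j + (1 - u j) * X K * D j i) / 2 = - (X K * \<Phi> / 2)"
          unfolding anti[OF ij] D[OF ij, symmetric] by (simp add: field_simps)
      qed
      also have "\<dots> = - (real (Suc k) * real k / 2) * \<Phi> * X K"
        using fin[OF K] card[OF K] by simp
      finally show ?thesis .
    qed
    then have "(\<Sum>K\<in>subsets_of_card S (Suc k). \<Sum>i\<in>K. \<Sum>j\<in>K - {i}. (1 - u i) * X K * D i j)
     = (\<Sum>K\<in>subsets_of_card S (Suc k). - (real (Suc k) * real k / 2) * \<Phi> * X K)"
      by (intro sum.cong refl) auto
    also have "\<dots> = - (real (Suc k) * real k / 2) * \<Phi> * elem_sym S (Suc k) u"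
      by (simp only: sum_distrib_left[symmetric] esum)
    finally show ?thesis by simp
  qed
  \<comment> \<open>Only \<open>i\<close> in \<open>K\<close>: with \<open>L = K - {i}\<close> and
    \<open>X K = u i * X L\<close>, both \<open>i\<close> and \<open>j\<close> range outside
    \<open>L\<close>, which restores the symmetry. The average contains
    \<open>u i * (1 - u i) - u j * (1 - u j)\<close>, the product of \<open>u i - u j\<close> and
    \<open>1 - u i - u j\<close>.\<close>
  have Tb: "(\<Sum>K\<in>subsets_of_card S (Suc k). \<Sum>i\<in>K. \<Sum>j\<in>S - K. (1 - u i) * X K * D i j)
     = real (r - k) * real (r - Suc k) / 2 * elem_sym S k u * \<Phi> -
       real (r - Suc k) * real (Suc k) * elem_sym S (Suc k) u * \<Phi>"
  proof -
    have "(\<Sum>K\<in>subsets_of_card S (Suc k). \<Sum>i\<in>K. \<Sum>j\<in>S - K. (1 - u i) * X K * D i j) =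
       (\<Sum>K\<in>subsets_of_card S (Suc k). \<Sum>i\<in>K. \<Sum>j\<in>S - (K - {i}) - {i}. X (K - {i}) * ((1 - u i) * u i * D i j))"
    proof (intro sum.cong refl)
      fix K i j assume *: "K \<in> subsets_of_card S (Suc k)" "i \<in> K"
      then show "S - K = S - (K - {i}) - {i}" by auto
      show "(1 - u i) * X K * D i j = X (K - {i}) * ((1 - u i) * u i * D i j)"
        using X[OF fin[OF *(1)] *(2)] by simp
    qed
    also have "\<dots> = (\<Sum>L\<in>subsets_of_card S k. \<Sum>i\<in>S - L. \<Sum>j\<in>S - L - {i}. X L * ((1 - u i) * u i * D i j))"
      by (rule sum_subsets_of_card_Suc[OF assms(1), of "\<lambda>L i. \<Sum>j\<in>S - L - {i}. X L * ((1 - u i) * u i * D i j)"])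
    also have "\<dots> = (\<Sum>L\<in>subsets_of_card S k. real (r - k) * real (r - Suc k) / 2 * \<Phi> * X L
       - real (r - Suc k) * \<Phi> * (X L * (\<Sum>i\<in>S - L. u i)))"
    proof (intro sum.cong refl)
      fix L assume L: "L \<in> subsets_of_card S k"
      have fL: "finite (S - L)" using assms(1) by simp
      have c: "card (S - L - {i}) = r - Suc k" if "i \<in> S - L" for i
        using that cardc[OF L] fL by (simp add: card_Diff_singleton)
      have "(\<Sum>i\<in>S - L. \<Sum>j\<in>S - L - {i}. X L * ((1 - u i) * u i * D i j)) =
        (\<Sum>i\<in>S - L. \<Sum>j\<in>S - L - {i}. (X L * ((1 - u i) * u i * D i j) + X L * ((1 - u j) * u j * D j i)) / 2)"
        by (rule sum_pairs_symmetrize[OF fL])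
      also have "\<dots> = (\<Sum>i\<in>S - L. \<Sum>j\<in>S - L - {i}. (X L * \<Phi> / 2 - X L * \<Phi> * u i / 2) + (- X L * \<Phi> * u j / 2))"
      proof (intro sum.cong refl)
        fix i j assume "i \<in> S - L" "j \<in> S - L - {i}"
        then have ij: "i \<in> S" "j \<in> S" "i \<noteq> j" by auto
        show "(X L * ((1 - u i) * u i * D i j) + X L * ((1 - u j) * u j * D j i)) / 2 =
          (X L * \<Phi> / 2 - X L * \<Phi> * u i / 2) + (- X L * \<Phi> * u j / 2)"
          unfolding anti[OF ij] D[OF ij, symmetric] by (simp add: field_simps)
      qed
      also have "\<dots> = (\<Sum>i\<in>S - L. \<Sum>j\<in>S - L - {i}. X L * \<Phi> / 2 - X L * \<Phi> * u i / 2) +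
          (\<Sum>i\<in>S - L. \<Sum>j\<in>S - L - {i}. - X L * \<Phi> * u j / 2)"
        by (simp only: sum.distrib)
      also have "(\<Sum>i\<in>S - L. \<Sum>j\<in>S - L - {i}. - X L * \<Phi> * u j / 2) = (\<Sum>i\<in>S - L. \<Sum>j\<in>S - L - {i}. - X L * \<Phi> * u i / 2)"
        using sum_pairs_symmetrize[OF fL, of "\<lambda>i j. - X L * \<Phi> * u j / 2"]
          sum_pairs_symmetrize[OF fL, of "\<lambda>i j. - X L * \<Phi> * u i / 2"] by (simp add: add.commute)
      also have "(\<Sum>i\<in>S - L. \<Sum>j\<in>S - L - {i}. X L * \<Phi> / 2 - X L * \<Phi> * u i / 2) +
         (\<Sum>i\<in>S - L. \<Sum>j\<in>S - L - {i}. - X L * \<Phi> * u i / 2)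
         = (\<Sum>i\<in>S - L. real (r - Suc k) * (X L * \<Phi> / 2) - real (r - Suc k) * \<Phi> * X L * u i)"
        unfolding sum.distrib[symmetric] by (intro sum.cong refl, simp only: sum_constant c) (simp add: field_simps)
      also have "\<dots> = real (r - k) * real (r - Suc k) / 2 * \<Phi> * X L - real (r - Suc k) * \<Phi> * (X L * (\<Sum>i\<in>S - L. u i))"
        by (simp add: sum_subtractf cardc[OF L] sum_distrib_left mult_ac)
      finally show "(\<Sum>i\<in>S - L. \<Sum>j\<in>S - L - {i}. X L * ((1 - u i) * u i * D i j)) = \<dots>" .
    qed
    also have "\<dots> = real (r - k) * real (r - Suc k) / 2 * \<Phi> * elem_sym S k u -
       real (r - Suc k) * \<Phi> * (real (Suc k) * elem_sym S (Suc k) u)"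
      by (simp only: sum_subtractf sum_distrib_left[symmetric] esum Xu)
    finally show ?thesis by simp
  qed
  have "(\<Sum>K\<in>subsets_of_card S (Suc k). \<Sum>i\<in>K. \<Sum>j\<in>S - {i}. (1 - u i) * X K * D i j) =
    (\<Sum>K\<in>subsets_of_card S (Suc k). \<Sum>i\<in>K. (\<Sum>j\<in>K - {i}. (1 - u i) * X K * D i j) + (\<Sum>j\<in>S - K. (1 - u i) * X K * D i j))"
  proof (intro sum.cong refl)
    fix K i assume *: "K \<in> subsets_of_card S (Suc k)" "i \<in> K"
    then have "S - {i} = (K - {i}) \<union> (S - K)" using sub by blast
    then show "(\<Sum>j\<in>S - {i}. (1 - u i) * X K * D i j) =
      (\<Sum>j\<in>K - {i}. (1 - u i) * X K * D i j) + (\<Sum>j\<in>S - K. (1 - u i) * X K * D i j)"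
      using fin[OF *(1)] assms(1) by (subst sum.union_disjoint[symmetric]) auto
  qed
  also have "\<dots> = (\<Sum>K\<in>subsets_of_card S (Suc k). \<Sum>i\<in>K. \<Sum>j\<in>K - {i}. (1 - u i) * X K * D i j) +
    (\<Sum>K\<in>subsets_of_card S (Suc k). \<Sum>i\<in>K. \<Sum>j\<in>S - K. (1 - u i) * X K * D i j)"
    by (simp add: sum.distrib)
  finally have T3: "(\<Sum>K\<in>subsets_of_card S (Suc k). \<Sum>i\<in>K. \<Sum>j\<in>S - {i}. (1 - u i) * X K * D i j) = \<dots>" .
  show ?thesis
    unfolding sum.distrib sum_subtractf T1 T2 T3 Ta Tb by (simp add: algebra_simps add_divide_distrib)
qed

section \<open>Ordered points and a calculus of bounded measurable functions\<close>

definition sorted_upto :: "nat \<Rightarrow> (nat \<Rightarrow> real) \<Rightarrow> bool" where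
  "sorted_upto r u \<longleftrightarrow> (\<forall>t. Suc t < r \<longrightarrow> u t \<le> u (Suc t))"

lemma sorted_uptoD:
  assumes "sorted_upto r u" "i \<le> j" "j < r"
  shows "u i \<le> u j"
  using assms(2,3)
proof (induction j rule: dec_induct)
  case (step j)
  then show ?case using assms(1) by (force simp: sorted_upto_def)
qed simp

lemma vandermonde_nonneg: "sorted_upto r u \<Longrightarrow> 0 \<le> vandermonde r u"
  unfolding vandermonde_def by (intro prod_nonneg) (auto intro: sorted_uptoD)

definition bounded_measurable :: "nat \<Rightarrow> ((nat \<Rightarrow> real) \<Rightarrow> real) \<Rightarrow> bool" where
  "bounded_measurable r f \<longleftrightarrow> f \<in> borel_measurable (cube {..<r}) \<and> (\<exists>C. \<forall>u\<in>space (cube {..<r}). \<bar>f u\<bar> \<le> C)"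

lemma bounded_measurable_integrable: "bounded_measurable r f \<Longrightarrow> integrable (cube {..<r}) f"
proof -
  interpret prob_space "cube {..<r}" by (rule prob_space_cube)
  assume "bounded_measurable r f"
  then obtain C where "f \<in> borel_measurable (cube {..<r})" "\<forall>u\<in>space (cube {..<r}). \<bar>f u\<bar> \<le> C"
    by (auto simp: bounded_measurable_def)
  then show ?thesis by (intro integrable_const_bound[of _ C]) auto
qed

lemma bounded_measurable_const: "bounded_measurable r (\<lambda>_. c)"
  by (auto simp: bounded_measurable_def)

lemma bounded_measurable_component: "t < r \<Longrightarrow> bounded_measurable r (\<lambda>u. u t)"
  by (auto simp: bounded_measurable_def measurable_cube_component dest: in_space_cube intro!: exI[of _ 1])

lemma bounded_measurable_add:
  assumes "bounded_measurable r f" "bounded_measurable r g"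
  shows "bounded_measurable r (\<lambda>u. f u + g u)"
proof -
  obtain A B where "\<forall>u\<in>space (cube {..<r}). \<bar>f u\<bar> \<le> A" "\<forall>u\<in>space (cube {..<r}). \<bar>g u\<bar> \<le> B"
    using assms by (auto simp: bounded_measurable_def)
  then have "\<bar>f u + g u\<bar> \<le> A + B" if "u \<in> space (cube {..<r})" for u
    using that by (intro order.trans[OF abs_triangle_ineq] add_mono) auto
  then show ?thesis using assms by (auto simp: bounded_measurable_def)
qed

lemma bounded_measurable_mult:
  assumes "bounded_measurable r f" "bounded_measurable r g"
  shows "bounded_measurable r (\<lambda>u. f u * g u)"
proof -
  obtain A B where "\<forall>u\<in>space (cube {..<r}). \<bar>f u\<bar> \<le> A" "\<forall>u\<in>space (cube {..<r}). \<bar>g u\<bar> \<le> B"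
    using assms by (auto simp: bounded_measurable_def)
  then have "\<bar>f u * g u\<bar> \<le> A * B" if "u \<in> space (cube {..<r})" for u
    using that unfolding abs_mult by (intro mult_mono) (auto intro: order.trans[OF abs_ge_zero])
  then show ?thesis using assms by (auto simp: bounded_measurable_def)
qed

lemma bounded_measurable_diff:
  assumes "bounded_measurable r f" "bounded_measurable r g"
  shows "bounded_measurable r (\<lambda>u. f u - g u)"
  using bounded_measurable_add[OF assms(1) bounded_measurable_mult[OF bounded_measurable_const[of r "-1"] assms(2)]]
  by simp

lemma bounded_measurable_power: "bounded_measurable r f \<Longrightarrow> bounded_measurable r (\<lambda>u. f u ^ k)"
  by (induction k) (auto intro: bounded_measurable_const bounded_measurable_mult)

lemma bounded_measurable_sum:
  "(\<And>i. i \<in> A \<Longrightarrow> bounded_measurable r (f i)) \<Longrightarrow> bounded_measurable r (\<lambda>u. \<Sum>i\<in>A. f i u)"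
  by (induction A rule: infinite_finite_induct) (auto intro: bounded_measurable_const bounded_measurable_add)

lemma bounded_measurable_prod:
  "(\<And>i. i \<in> A \<Longrightarrow> bounded_measurable r (f i)) \<Longrightarrow> bounded_measurable r (\<lambda>u. \<Prod>i\<in>A. f i u)"
  by (induction A rule: infinite_finite_induct) (auto intro: bounded_measurable_const bounded_measurable_mult)

lemma sets_sorted_upto: "{u \<in> space (cube {..<r}). sorted_upto r u} \<in> sets (cube {..<r})"
proof -
  have "{u \<in> space (cube {..<r}). \<forall>a\<in>{..<r}. \<forall>b\<in>{..<r}. b = Suc a \<longrightarrow> u a \<le> u b} \<in> sets (cube {..<r})"
    by (intro sets_Collect_Ball_cube) (auto intro: borel_measurable_le measurable_cube_component)
  also have "{u \<in> space (cube {..<r}). \<forall>a\<in>{..<r}. \<forall>b\<in>{..<r}. b = Suc a \<longrightarrow> u a \<le> u b} =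
    {u \<in> space (cube {..<r}). sorted_upto r u}"
    by (auto simp: sorted_upto_def)
  finally show ?thesis .
qed

lemma bounded_measurable_sorted: "bounded_measurable r (\<lambda>u. of_bool (sorted_upto r u))"
proof -
  have "(\<lambda>u. indicator {u \<in> space (cube {..<r}). sorted_upto r u} u :: real) \<in> borel_measurable (cube {..<r})"
    using sets_sorted_upto by simp
  also have "?this \<longleftrightarrow> (\<lambda>u. of_bool (sorted_upto r u) :: real) \<in> borel_measurable (cube {..<r})"
    by (intro measurable_cong) (auto simp: indicator_def)
  finally show ?thesis unfolding bounded_measurable_def by (auto intro!: exI[of _ 1])
qed

lemmas bounded_measurable_intros =
  bounded_measurable_sorted bounded_measurable_prod bounded_measurable_sum bounded_measurable_power
  bounded_measurable_diff bounded_measurable_mult bounded_measurable_add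
  bounded_measurable_component bounded_measurable_const

section \<open>Derivatives of the Vandermonde product and integration by parts\<close>

definition index_pairs :: "nat \<Rightarrow> (nat \<times> nat) set" where
  "index_pairs r = Sigma {..<r} (\<lambda>j. {..<j})"

text \<open>This is the Vandermonde product divided by \<open>u i - u j\<close>, written with the
  factor left out so that it stays a polynomial; the sign accounts for the order of \<open>i\<close>
  and \<open>j\<close>.\<close>

definition vandermonde_omit :: "nat \<Rightarrow> nat \<Rightarrow> nat \<Rightarrow> (nat \<Rightarrow> real) \<Rightarrow> real" where
  "vandermonde_omit r i j u =
     (if j < i then 1 else - 1) * (\<Prod>p\<in>index_pairs r - {(max i j, min i j)}. u (fst p) - u (snd p))"

lemma finite_index_pairs: "finite (index_pairs r)"
  by (simp add: index_pairs_def)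

lemma vandermonde_index_pairs: "vandermonde r u = (\<Prod>p\<in>index_pairs r. u (fst p) - u (snd p))"
  unfolding vandermonde_def index_pairs_def by (subst prod.Sigma) (auto simp: case_prod_beta)

lemma vandermonde_omit_swap: "i \<noteq> j \<Longrightarrow> vandermonde_omit r j i u = - vandermonde_omit r i j u"
  by (auto simp: vandermonde_omit_def max.commute min.commute)

lemma vandermonde_omit_mult:
  assumes "i < r" "j < r" "i \<noteq> j"
  shows "vandermonde_omit r i j u * (u i - u j) = vandermonde r u"
proof -
  have "(max i j, min i j) \<in> index_pairs r" using assms by (auto simp: index_pairs_def)
  then have "vandermonde r u = (u (max i j) - u (min i j)) * (\<Prod>p\<in>index_pairs r - {(max i j, min i j)}. u (fst p) - u (snd p))"
    unfolding vandermonde_index_pairs by (subst prod.remove[OF finite_index_pairs]) auto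
  then show ?thesis using assms by (auto simp: vandermonde_omit_def max_def min_def algebra_simps)
qed

text \<open>In the product rule over pairs only the pairs containing \<open>i\<close> contribute,
  one for each \<open>j \<noteq> i\<close>.\<close>

lemma DERIV_vandermonde:
  assumes "i < r"
  shows "((\<lambda>y. vandermonde r (u(i := y))) has_real_derivative
    (\<Sum>j\<in>{..<r} - {i}. vandermonde_omit r i j (u(i := z)))) (at z)"
proof -
  define f where "f p y = (u(i := y)) (fst p) - (u(i := y)) (snd p)" for p y
  define f' :: "nat \<times> nat \<Rightarrow> real" where "f' p = (if fst p = i then 1 else 0) - (if snd p = i then 1 else 0)" for p
  have "((\<lambda>y. \<Prod>p\<in>index_pairs r. f p y) has_real_derivative
    (\<Sum>p\<in>index_pairs r. f' p * (\<Prod>q\<in>index_pairs r - {p}. f q z))) (at z)"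
    by (intro has_field_derivative_prod) (auto simp: f_def f'_def intro!: derivative_eq_intros)
  also have "(\<Sum>p\<in>index_pairs r. f' p * (\<Prod>q\<in>index_pairs r - {p}. f q z)) =
    (\<Sum>p\<in>(\<lambda>j. (max i j, min i j)) ` ({..<r} - {i}). f' p * (\<Prod>q\<in>index_pairs r - {p}. f q z))"
  proof (intro sum.mono_neutral_right finite_index_pairs ballI)
    show "(\<lambda>j. (max i j, min i j)) ` ({..<r} - {i}) \<subseteq> index_pairs r"
      using assms by (auto simp: index_pairs_def)
    fix p assume p: "p \<in> index_pairs r - (\<lambda>j. (max i j, min i j)) ` ({..<r} - {i})"
    have "fst p \<noteq> i \<and> snd p \<noteq> i"
    proof (rule ccontr)
      assume "\<not> ?thesis"
      then have "p \<in> (\<lambda>j. (max i j, min i j)) ` ({..<r} - {i})"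
        using p by (intro image_eqI[of _ _ "if fst p = i then snd p else fst p"]) (auto simp: index_pairs_def)
      then show False using p by blast
    qed
    then show "f' p * (\<Prod>q\<in>index_pairs r - {p}. f q z) = 0" by (simp add: f'_def)
  qed
  also have "\<dots> = (\<Sum>j\<in>{..<r} - {i}. f' (max i j, min i j) * (\<Prod>q\<in>index_pairs r - {(max i j, min i j)}. f q z))"
    by (subst sum.reindex) (auto simp: inj_on_def max_def min_def split: if_splits)
  also have "\<dots> = (\<Sum>j\<in>{..<r} - {i}. vandermonde_omit r i j (u(i := z)))"
    by (intro sum.cong refl) (auto simp: vandermonde_omit_def f'_def f_def max_def min_def)
  finally show ?thesis by (simp add: vandermonde_index_pairs f_def)
qed

definition beta_weight :: "nat \<Rightarrow> nat \<Rightarrow> nat \<Rightarrow> (nat \<Rightarrow> real) \<Rightarrow> real" where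
  "beta_weight r s b u = (\<Prod>t<r. u t ^ s * (1 - u t) ^ b)"

definition selberg_integral :: "nat \<Rightarrow> nat \<Rightarrow> nat \<Rightarrow> real" where
  "selberg_integral r s b =
     (\<integral>u. of_bool (sorted_upto r u) * (beta_weight r s b u * vandermonde r u) \<partial>cube {..<r})"

text \<open>For \<open>i \<in> K\<close> this is the partial derivative in \<open>u i\<close> of
  \<open>(1 - u i) * X K * \<Phi>\<close>, expanded. The factors \<open>1 - u i\<close> and
  \<open>u i\<close> (the latter from \<open>X K\<close>) make that function vanish at 1 and 0 even
  when \<open>b\<close> or \<open>s\<close> is 0.\<close>

definition aomoto_term :: "nat \<Rightarrow> nat \<Rightarrow> nat \<Rightarrow> nat set \<Rightarrow> nat \<Rightarrow> (nat \<Rightarrow> real) \<Rightarrow> real" where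
  "aomoto_term r s b K i u =
     (let X = \<lambda>K. \<Prod>l\<in>K. u l; \<Phi> = beta_weight r s b u * vandermonde r u in
     (real s + 1) * X (K - {i}) * \<Phi> - (real s + real b + 2) * X K * \<Phi> +
     (\<Sum>j\<in>{..<r} - {i}. (1 - u i) * X K * (beta_weight r s b u * vandermonde_omit r i j u)))"

lemma bounded_measurable_aomoto_term:
  assumes "K \<subseteq> {..<r}" "i < r"
  shows "bounded_measurable r (aomoto_term r s b K i)"
  unfolding aomoto_term_def[abs_def] Let_def beta_weight_def vandermonde_index_pairs vandermonde_omit_def
  using assms by (intro bounded_measurable_intros) (auto simp: index_pairs_def)

lemma DERIV_aomoto:
  assumes "K \<subseteq> {..<r}" "i \<in> K"
  shows "((\<lambda>y. (1 - y) * (\<Prod>l\<in>K. (u(i := y)) l) * (beta_weight r s b (u(i := y)) * vandermonde r (u(i := y))))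
    has_real_derivative aomoto_term r s b K i (u(i := z))) (at z)"
proof -
  have i: "i < r" "finite K" using assms by (auto intro: finite_subset)
  define A where "A = (\<Prod>l\<in>K - {i}. u l)"
  define B where "B = (\<Prod>t\<in>{..<r} - {i}. u t ^ s * (1 - u t) ^ b)"
  have A: "(\<Prod>l\<in>K. (u(i := y)) l) = y * A" "(\<Prod>l\<in>K - {i}. (u(i := y)) l) = A" for y
    using i assms by (auto simp: A_def prod.remove[of K i] intro!: prod.cong)
  have B: "beta_weight r s b (u(i := y)) = y ^ s * (1 - y) ^ b * B" for y
    using i unfolding beta_weight_def B_def by (subst prod.remove[of _ i]) (auto intro!: prod.cong)
  have "((\<lambda>y. A * B * (y ^ Suc s * (1 - y) ^ Suc b) * vandermonde r (u(i := y))) has_real_derivative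
     A * B * ((1 - z) ^ b * (real (Suc s) * z ^ (Suc s - 1) * (1 - z) - real (Suc b) * z ^ Suc s)) * vandermonde r (u(i := z))
     + (\<Sum>j\<in>{..<r} - {i}. vandermonde_omit r i j (u(i := z))) * (A * B * (z ^ Suc s * (1 - z) ^ Suc b))) (at z)"
    by (intro DERIV_mult DERIV_cmult DERIV_beta_weight DERIV_vandermonde i)
  also have "(\<lambda>y. A * B * (y ^ Suc s * (1 - y) ^ Suc b) * vandermonde r (u(i := y))) =
    (\<lambda>y. (1 - y) * (\<Prod>l\<in>K. (u(i := y)) l) * (beta_weight r s b (u(i := y)) * vandermonde r (u(i := y))))"
    unfolding A B by (simp add: fun_eq_iff mult_ac)
  also have "A * B * ((1 - z) ^ b * (real (Suc s) * z ^ (Suc s - 1) * (1 - z) - real (Suc b) * z ^ Suc s)) * vandermonde r (u(i := z))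
     + (\<Sum>j\<in>{..<r} - {i}. vandermonde_omit r i j (u(i := z))) * (A * B * (z ^ Suc s * (1 - z) ^ Suc b))
    = aomoto_term r s b K i (u(i := z))"
    unfolding aomoto_term_def Let_def A B
    by (simp add: sum_distrib_left sum_distrib_right sum_subtractf algebra_simps)
  finally show ?thesis .
qed

text \<open>The integral over \<open>u i\<close> alone, between its two neighbours, already
  vanishes. At a neighbour two arguments of the Vandermonde product coincide; at 0 and 1, where a
  neighbour is missing, the factors \<open>u i\<close> and \<open>1 - u i\<close> vanish.\<close>

lemma integral_aomoto_term:
  assumes "K \<subseteq> {..<r}" "i \<in> K"
  shows "(\<integral>u. of_bool (sorted_upto r u) * aomoto_term r s b K i u \<partial>cube {..<r}) = 0"
proof -
  have i: "i < r" using assms by auto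
  define I where "I = {..<r} - {i}"
  have I: "{..<r} = insert i I" "finite I" "i \<notin> I" using i by (auto simp: I_def)
  let ?h = "\<lambda>u. of_bool (sorted_upto r u) * aomoto_term r s b K i u"
  have "integrable (cube {..<r}) ?h"
    using assms i by (intro bounded_measurable_integrable bounded_measurable_mult
        bounded_measurable_sorted bounded_measurable_aomoto_term)
  then have "(\<integral>u. ?h u \<partial>cube {..<r}) = (\<integral>x. (\<integral>y. ?h (x(i := y)) \<partial>uniform01) \<partial>cube I)"
    using uniform01s.product_integral_insert[OF I(2,3), of ?h] I(1) by simp
  also have "\<dots> = (\<integral>x. 0 \<partial>cube I)"
  proof (intro Bochner_Integration.integral_cong refl)
    fix x assume x: "x \<in> space (cube I)"
    have x01: "x t \<in> {0..1}" if "t < r" "t \<noteq> i" for t using in_space_cube[OF x] that by (auto simp: I_def)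
    define lo hi where "lo = (if i = 0 then 0 else x (i - 1))" and "hi = (if Suc i < r then x (Suc i) else 1)"
    \<comment> \<open>The part of the ordering that does not involve coordinate \<open>i\<close>;
      the rest says that \<open>y\<close> lies between \<open>lo\<close> and
      \<open>hi\<close>.\<close>
    define c :: real where "c = of_bool (\<forall>t. Suc t < r \<and> t \<noteq> i \<and> Suc t \<noteq> i \<longrightarrow> x t \<le> x (Suc t))"
    have b: "0 \<le> lo" "lo \<le> 1" "0 \<le> hi" "hi \<le> 1"
      using x01[of "i - 1"] x01[of "Suc i"] i by (auto simp: lo_def hi_def)
    have sorted: "of_bool (sorted_upto r (x(i := y))) = c * indicator {lo..hi} y" if "y \<in> {0..1}" for y
    proof -
      have "sorted_upto r (x(i := y)) \<longleftrightarrow> (\<forall>t. Suc t < r \<and> t \<noteq> i \<and> Suc t \<noteq> i \<longrightarrow> x t \<le> x (Suc t)) \<and> lo \<le> y \<and> y \<le> hi"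
        (is "?L \<longleftrightarrow> ?R")
      proof
        assume L: ?L
        then have *: "(x(i := y)) t \<le> (x(i := y)) (Suc t)" if "Suc t < r" for t
          using that by (simp add: sorted_upto_def)
        have "lo \<le> y" using *[of "i - 1"] i that by (cases i) (auto simp: lo_def)
        moreover have "y \<le> hi" using *[of i] that by (auto simp: hi_def)
        moreover have "x t \<le> x (Suc t)" if "Suc t < r" "t \<noteq> i" "Suc t \<noteq> i" for t
          using *[of t] that by simp
        ultimately show ?R by blast
      next
        assume R: ?R
        show ?L unfolding sorted_upto_def
        proof (intro allI impI)
          fix t assume t: "Suc t < r"
          consider "t = i" | "Suc t = i" | "t \<noteq> i" "Suc t \<noteq> i" by blast
          then show "(x(i := y)) t \<le> (x(i := y)) (Suc t)"
            using R t by cases (auto simp: lo_def hi_def)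
        qed
      qed
      then show ?thesis by (auto simp: c_def indicator_def)
    qed
    define G where "G y = (1 - y) * (\<Prod>l\<in>K. (x(i := y)) l) * (beta_weight r s b (x(i := y)) * vandermonde r (x(i := y)))" for y
    have V0: "vandermonde r (x(i := y)) = 0" if "j < r" "j \<noteq> i" "y = x j" for y j
      using vandermonde_omit_mult[of i r j "x(i := y)"] that i by simp
    have Glo: "G lo = 0"
    proof (cases "i = 0")
      case True
      have "finite K" using assms(1) by (rule finite_subset) simp
      then have "(\<Prod>l\<in>K. (x(i := lo)) l) = 0"
        using assms(2) True by (intro prod_zero) (auto simp: lo_def intro!: bexI[of _ i])
      then show ?thesis unfolding G_def by simp
    next
      case False
      then show ?thesis using V0[of "i - 1" lo] i by (cases i) (auto simp: G_def lo_def)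
    qed
    have Ghi: "G hi = 0" using V0[of "Suc i" hi] by (auto simp: G_def hi_def)
    have "(\<integral>y. ?h (x(i := y)) \<partial>uniform01) =
        (\<integral>y. c * (indicator {lo..hi} y * aomoto_term r s b K i (x(i := y))) \<partial>uniform01)"
      by (intro Bochner_Integration.integral_cong refl) (simp add: sorted)
    also have "\<dots> = c * (\<integral>y. indicator {lo..hi} y * aomoto_term r s b K i (x(i := y)) \<partial>uniform01)" by simp
    also have "(\<integral>y. indicator {lo..hi} y * aomoto_term r s b K i (x(i := y)) \<partial>uniform01) = 0"
    proof (cases "lo \<le> hi")
      case True
      have "has_bochner_integral uniform01 (\<lambda>y. indicator {lo..hi} y * aomoto_term r s b K i (x(i := y))) (G hi - G lo)"
      proof (rule has_bochner_integral_uniform01_FTC)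
        show "(G has_real_derivative aomoto_term r s b K i (x(i := y))) (at y)" for y
          unfolding G_def using assms by (rule DERIV_aomoto)
        have comp: "continuous_on UNIV (\<lambda>y. (x(i := y)) t)" for t by (cases "t = i") (auto intro!: continuous_intros)
        show "continuous_on UNIV (\<lambda>y. aomoto_term r s b K i (x(i := y)))"
          unfolding aomoto_term_def Let_def beta_weight_def vandermonde_index_pairs vandermonde_omit_def
          by (intro continuous_intros comp)
      qed (use True b in auto)
      then show ?thesis using Glo Ghi by (simp add: has_bochner_integral_iff)
    qed simp
    finally show "(\<integral>y. ?h (x(i := y)) \<partial>uniform01) = 0" by (simp only: mult_zero_right)
  qed
  finally show ?thesis by simp
qed

text \<open>\<open>M k\<close> is the integral weighted by the \<open>k\<close>-th elementary
  symmetric polynomial. Summing the vanishing integrals over all \<open>K\<close> of size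
  \<open>Suc k\<close> and all \<open>i \<in> K\<close> relates \<open>M k\<close> to
  \<open>M (Suc k)\<close>; doubling clears the halves.\<close>

lemma Aomoto_recurrence:
  fixes r s b :: nat
  defines "M \<equiv> \<lambda>k. \<integral>u. of_bool (sorted_upto r u) * (elem_sym {..<r} k u * (beta_weight r s b u * vandermonde r u)) \<partial>cube {..<r}"
  assumes "k < r"
  shows "(real (r - k) * (2 * real s + 2 + real (r - Suc k))) * M k =
    (real (Suc k) * (2 * real s + 2 * real b + 4 + real k + 2 * real (r - Suc k))) * M (Suc k)"
proof -
  let ?\<Phi> = "\<lambda>u. beta_weight r s b u * vandermonde r u"
  define a where "a = real (r - k) * (real s + 1) + real (r - k) * real (r - Suc k) / 2"
  define c where "c = real (Suc k) * ((real s + real b + 2) + real k / 2 + real (r - Suc k))"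
  have bm: "bounded_measurable r (\<lambda>u. of_bool (sorted_upto r u) * (elem_sym {..<r} k u * ?\<Phi> u))" for k
    unfolding elem_sym_def beta_weight_def vandermonde_index_pairs
    by (intro bounded_measurable_intros) (auto simp: index_pairs_def subsets_of_card_def)
  have "0 = (\<Sum>K\<in>subsets_of_card {..<r} (Suc k). \<Sum>i\<in>K. \<integral>u. of_bool (sorted_upto r u) * aomoto_term r s b K i u \<partial>cube {..<r})"
    by (intro sum.neutral[symmetric] ballI sum.neutral integral_aomoto_term) (auto simp: subsets_of_card_def)
  also have "\<dots> = (\<integral>u. (\<Sum>K\<in>subsets_of_card {..<r} (Suc k). \<Sum>i\<in>K. of_bool (sorted_upto r u) * aomoto_term r s b K i u) \<partial>cube {..<r})"
  proof -
    have bmt: "bounded_measurable r (\<lambda>u. of_bool (sorted_upto r u) * aomoto_term r s b K i u)"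
      if "K \<in> subsets_of_card {..<r} (Suc k)" "i \<in> K" for K i
      using that by (intro bounded_measurable_mult bounded_measurable_sorted bounded_measurable_aomoto_term)
        (auto simp: subsets_of_card_def)
    show ?thesis
      by (subst Bochner_Integration.integral_sum)
         (auto intro!: bounded_measurable_integrable bounded_measurable_sum bmt sum.cong Bochner_Integration.integral_sum[symmetric])
  qed
  also have "\<dots> = (\<integral>u. a * (of_bool (sorted_upto r u) * (elem_sym {..<r} k u * ?\<Phi> u)) -
      c * (of_bool (sorted_upto r u) * (elem_sym {..<r} (Suc k) u * ?\<Phi> u)) \<partial>cube {..<r})"
  proof (intro Bochner_Integration.integral_cong refl)
    fix u :: "nat \<Rightarrow> real"
    have "(\<Sum>K\<in>subsets_of_card {..<r} (Suc k). \<Sum>i\<in>K. aomoto_term r s b K i u) =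
      a * elem_sym {..<r} k u * ?\<Phi> u - c * elem_sym {..<r} (Suc k) u * ?\<Phi> u"
      unfolding a_def c_def aomoto_term_def Let_def
    proof (rule Aomoto_identity)
      fix i j assume ij: "i \<in> {..<r}" "j \<in> {..<r}" "i \<noteq> j"
      show "beta_weight r s b u * vandermonde_omit r j i u = - (beta_weight r s b u * vandermonde_omit r i j u)"
        using vandermonde_omit_swap[OF ij(3)] by simp
      show "beta_weight r s b u * vandermonde_omit r i j u * (u i - u j) = ?\<Phi> u"
        using vandermonde_omit_mult[of i r j u] ij by (simp add: mult.assoc)
    qed (use assms in auto)
    then show "(\<Sum>K\<in>subsets_of_card {..<r} (Suc k). \<Sum>i\<in>K. of_bool (sorted_upto r u) * aomoto_term r s b K i u) =
      a * (of_bool (sorted_upto r u) * (elem_sym {..<r} k u * ?\<Phi> u)) -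
      c * (of_bool (sorted_upto r u) * (elem_sym {..<r} (Suc k) u * ?\<Phi> u))"
      by (simp add: sum_distrib_left[symmetric] algebra_simps)
  qed
  also have "\<dots> = a * M k - c * M (Suc k)"
    unfolding M_def
    by (subst Bochner_Integration.integral_diff)
       (simp_all add: bounded_measurable_integrable bm)
  finally have "2 * (a * M k) = 2 * (c * M (Suc k))" by simp
  then show ?thesis unfolding a_def c_def by (simp add: field_simps)
qed

text \<open>The recurrence is iterated from the polynomial of degree 0, which is 1, to that of
  degree \<open>r\<close>, the product of all points, which raises the exponent \<open>s\<close> by
  one.\<close>

lemma selberg_integral_shift:
  "selberg_integral r (Suc s) b * (\<Prod>j<r. 2 * real s + 2 * real b + real r + 3 + real j) =
   selberg_integral r s b * (\<Prod>j<r. 2 * real s + 2 + real j)"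
proof -
  define M where "M k = (\<integral>u. of_bool (sorted_upto r u) * (elem_sym {..<r} k u * (beta_weight r s b u * vandermonde r u)) \<partial>cube {..<r})" for k
  define A where "A k = real (r - k) * (2 * real s + 2 + real (r - Suc k))" for k
  define B where "B k = real (Suc k) * (2 * real s + 2 * real b + 4 + real k + 2 * real (r - Suc k))" for k
  have "M k * (\<Prod>j<k. B j) = M 0 * (\<Prod>j<k. A j)" if "k \<le> r" for k
    using that
  proof (induction k)
    case (Suc k)
    have "A k * M k = B k * M (Suc k)"
      using Aomoto_recurrence[of k r s b] Suc.prems unfolding M_def A_def B_def by simp
    then have "M (Suc k) * (\<Prod>j<Suc k. B j) = A k * (M k * (\<Prod>j<k. B j))" by (simp add: mult_ac)
    then show ?case using Suc by (simp add: mult_ac)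
  qed simp
  note main = this[OF order.refl]
  have "subsets_of_card {..<r} 0 = {{}}" by (auto simp: subsets_of_card_def dest: finite_subset[OF _ finite_lessThan])
  then have M0: "M 0 = selberg_integral r s b" unfolding M_def selberg_integral_def elem_sym_def by simp
  have "subsets_of_card {..<r} r = {{..<r}}"
    using card_subset_eq[of "{..<r}"] by (auto simp: subsets_of_card_def)
  then have Mr: "M r = selberg_integral r (Suc s) b"
    unfolding M_def selberg_integral_def elem_sym_def beta_weight_def by (simp add: prod.distrib mult_ac)
  \<comment> \<open>Reversing the index turns \<open>r - Suc j\<close> into \<open>j\<close>; the
    common factors \<open>Suc j\<close> cancel in the end.\<close>
  have "(\<Prod>j<r. A j) = (\<Prod>j<r. real (Suc j)) * (\<Prod>j<r. 2 * real s + 2 + real j)"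
    using prod.nat_diff_reindex[of "\<lambda>j. real (Suc j) * (2 * real s + 2 + real j)" r]
    by (auto simp: A_def prod.distrib Suc_diff_Suc intro!: prod.cong)
  moreover have "(\<Prod>j<r. B j) = (\<Prod>j<r. real (Suc j)) * (\<Prod>j<r. 2 * real s + 2 * real b + real r + 3 + real j)"
  proof -
    have "(\<Prod>j<r. 2 * real s + 2 * real b + 4 + real j + 2 * real (r - Suc j)) =
      (\<Prod>j<r. 2 * real s + 2 * real b + real r + 3 + real (r - Suc j))"
      by (intro prod.cong refl) (auto simp: of_nat_diff)
    also have "\<dots> = (\<Prod>j<r. 2 * real s + 2 * real b + real r + 3 + real j)"
      by (rule prod.nat_diff_reindex)
    finally show ?thesis by (simp only: B_def prod.distrib)
  qed
  moreover have "(\<Prod>j<r. real (Suc j)) \<noteq> 0" by auto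
  ultimately show ?thesis using main unfolding M0 Mr by simp
qed

lemma selberg_integral_E1:
  assumes "r \<le> p"
  shows "selberg_integral r s (p - r) * E1 r p 0 = selberg_integral r 0 (p - r) * E1 r p s"
proof (induction s)
  case (Suc s)
  define P Q where "P = (\<Prod>j<r. 2 * real s + 2 * real p - real r + 3 + real j)"
    and "Q = (\<Prod>j<r. 2 * real s + 2 + real j)"
  have "P > 0" unfolding P_def using assms by (intro prod_pos) auto
  have "2 * real s + 2 * real (p - r) + real r + 3 + real j = 2 * real s + 2 * real p - real r + 3 + real j" for j
    using assms by (simp add: of_nat_diff)
  then have S: "selberg_integral r (Suc s) (p - r) * P = selberg_integral r s (p - r) * Q"
    using selberg_integral_shift[of r s "p - r"] unfolding P_def Q_def by simp
  have E: "E1 r p (Suc s) * P = E1 r p s * Q"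
    using E1_shift[OF assms, of s] unfolding P_def Q_def .
  have "(selberg_integral r (Suc s) (p - r) * E1 r p 0) * P = (selberg_integral r s (p - r) * E1 r p 0) * Q"
    using S by (simp add: mult_ac)
  also have "\<dots> = (selberg_integral r 0 (p - r) * E1 r p (Suc s)) * P"
    unfolding Suc.IH using E by (simp add: mult_ac)
  finally show ?case using \<open>P > 0\<close> by simp
qed simp

subsection \<open>The law of a diagonal\<close>

text \<open>Diagonals are indexed by \<open>d = m + j - i\<close>, so that \<open>d\<close> counts the diagonals from the lower left corner.\<close>

definition diagonals_upto :: "nat \<Rightarrow> nat \<Rightarrow> nat \<Rightarrow> diagram" where
  "diagonals_upto m n d = {(i, j). i < m \<and> j < n \<and> j + m \<le> i + d}"

text \<open>By truncated subtraction this is \<open>d\<close> up to \<open>n\<close>, then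
  \<open>n\<close> up to \<open>m\<close>, then \<open>n + m - d\<close>, for
  \<open>n \<le> m\<close> and \<open>d \<le> n + m\<close>.\<close>

definition diag_length :: "nat \<Rightarrow> nat \<Rightarrow> nat \<Rightarrow> nat" where
  "diag_length m n d = min d n - (d - m)"

text \<open>\<open>t\<close> runs from upper left to lower right; the two branches agree at
  \<open>d = m\<close>.\<close>

definition diag_cell :: "nat \<Rightarrow> nat \<Rightarrow> nat \<Rightarrow> nat \<times> nat" where
  "diag_cell m d t = (if d \<le> m then (m - d + t, t) else (t, t + d - m))"

definition diag_of :: "nat \<Rightarrow> nat \<Rightarrow> nat \<Rightarrow> (nat \<times> nat \<Rightarrow> real) \<Rightarrow> nat \<Rightarrow> real" where
  "diag_of m n d T = (\<lambda>t\<in>{..<diag_length m n d}. T (diag_cell m d t))"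

text \<open>For box \<open>t\<close> of diagonal \<open>d\<close> the values at \<open>t\<close> and
  \<open>Suc t\<close> are its upper and right neighbours on diagonal \<open>Suc d\<close>. From
  \<open>d = m\<close> on the diagonals start in row 0, which shifts the index by one and leaves the
  first box without an upper neighbour. The defaults are 0 and 1.\<close>

definition interlacing_bound :: "nat \<Rightarrow> nat \<Rightarrow> nat \<Rightarrow> (nat \<Rightarrow> real) \<Rightarrow> nat \<Rightarrow> real" where
  "interlacing_bound m n d v t =
    (if d < m then (if t < diag_length m n (Suc d) then v t else 1)
     else (if t = 0 then 0 else if t \<le> diag_length m n (Suc d) then v (t - 1) else 1))"

definition interlacing :: "nat \<Rightarrow> nat \<Rightarrow> nat \<Rightarrow> (nat \<Rightarrow> real) \<Rightarrow> (nat \<Rightarrow> real) \<Rightarrow> bool" where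
  "interlacing m n d v u \<longleftrightarrow> (\<forall>t<diag_length m n d.
     interlacing_bound m n d v t \<le> u t \<and> u t \<le> interlacing_bound m n d v (Suc t))"

lemma diagonals_upto_0 [simp]: "diagonals_upto m n 0 = {}"
  by (auto simp: diagonals_upto_def)

lemma finite_diagonals_upto: "finite (diagonals_upto m n d)"
  by (rule finite_subset[of _ "{..<m} \<times> {..<n}"]) (auto simp: diagonals_upto_def)

lemma diag_cells_eq:
  assumes "n \<le> m" "d \<le> n + m"
  shows "diag_cell m d ` {..<diag_length m n d} = {(i, j). i < m \<and> j < n \<and> j + m = i + d}" (is "?L = ?R")
proof
  show "?L \<subseteq> ?R" using assms by (auto simp: diag_cell_def diag_length_def)
  show "?R \<subseteq> ?L"
  proof
    fix p assume "p \<in> ?R"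
    then obtain i j where p: "p = (i, j)" "i < m" "j < n" "j + m = i + d" by auto
    show "p \<in> ?L"
      using p assms by (intro image_eqI[of _ _ "if d \<le> m then j else i"])
        (auto simp: diag_cell_def diag_length_def)
  qed
qed

lemma inj_diag_cell: "inj_on (diag_cell m d) A"
  by (auto simp: inj_on_def diag_cell_def split: if_splits)

lemma diagonals_upto_Suc:
  assumes "n \<le> m" "Suc d \<le> n + m"
  shows "diagonals_upto m n (Suc d) = diag_cell m (Suc d) ` {..<diag_length m n (Suc d)} \<union> diagonals_upto m n d"
    "diag_cell m (Suc d) ` {..<diag_length m n (Suc d)} \<inter> diagonals_upto m n d = {}"
  unfolding diag_cells_eq[OF assms] by (auto simp: diagonals_upto_def)

lemma diag_cell_in:
  assumes "n \<le> m" "d \<le> n + m" "t < diag_length m n d"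
  shows "diag_cell m d t \<in> diagonals_upto m n d"
proof -
  have "diag_cell m d t \<in> diag_cell m d ` {..<diag_length m n d}" using assms by auto
  then show ?thesis unfolding diag_cells_eq[OF assms(1,2)] by (auto simp: diagonals_upto_def)
qed

text \<open>A comparison reaching the new diagonal factors through a neighbour on diagonal
  \<open>d\<close>, so only adjacent boxes of the two diagonals give new conditions.\<close>

lemma weakly_increasing_Suc:
  "weakly_increasing (diagonals_upto m n (Suc d)) T \<longleftrightarrow> weakly_increasing (diagonals_upto m n d) T \<and>
    (\<forall>i j. i < m \<longrightarrow> j < n \<longrightarrow> j + m = i + d \<longrightarrow>
      (i \<noteq> 0 \<longrightarrow> T (i - 1, j) \<le> T (i, j)) \<and> (Suc j < n \<longrightarrow> T (i, j) \<le> T (i, Suc j)))"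
    (is "?L \<longleftrightarrow> ?W \<and> ?A")
proof
  assume L: ?L
  have row: "T (i, j) \<le> T (i, j')" if "(i, j) \<in> diagonals_upto m n (Suc d)" "(i, j') \<in> diagonals_upto m n (Suc d)" "j < j'" for i j j'
    using L that unfolding weakly_increasing_def by blast
  have col: "T (i, j) \<le> T (i', j)" if "(i, j) \<in> diagonals_upto m n (Suc d)" "(i', j) \<in> diagonals_upto m n (Suc d)" "i < i'" for i i' j
    using L that unfolding weakly_increasing_def by blast
  have "?W" unfolding weakly_increasing_def
    by (intro conjI allI impI row col) (auto simp: diagonals_upto_def)
  moreover have ?A
    by (intro conjI allI impI row col) (auto simp: diagonals_upto_def)
  ultimately show "?W \<and> ?A" ..
next
  assume R: "?W \<and> ?A"
  have row: "T (i, j) \<le> T (i, j')" if "(i, j) \<in> diagonals_upto m n d" "(i, j') \<in> diagonals_upto m n d" "j < j'" for i j j'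
    using R that unfolding weakly_increasing_def by blast
  have col: "T (i, j) \<le> T (i', j)" if "(i, j) \<in> diagonals_upto m n d" "(i', j) \<in> diagonals_upto m n d" "i < i'" for i i' j
    using R that unfolding weakly_increasing_def by blast
  have A1: "T (i, j) \<le> T (Suc i, j)" if "Suc i < m" "j < n" "j + m = Suc i + d" for i j
    using R that by fastforce
  have A2: "T (i, j) \<le> T (i, Suc j)" if "i < m" "Suc j < n" "j + m = i + d" for i j
    using R that by fastforce
  show ?L unfolding weakly_increasing_def
  proof (intro conjI allI impI)
    fix i j j' assume *: "(i, j) \<in> diagonals_upto m n (Suc d)" "(i, j') \<in> diagonals_upto m n (Suc d)" "j < j'"
    show "T (i, j) \<le> T (i, j')"
    proof (cases "(i, j') \<in> diagonals_upto m n d")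
      case True
      then show ?thesis using * by (intro row) (auto simp: diagonals_upto_def)
    next
      case False
      obtain j0 where j0: "j' = Suc j0" using *(3) by (cases j') auto
      have e: "j0 + m = i + d" "i < m" "Suc j0 < n" using False * j0 by (auto simp: diagonals_upto_def)
      have "T (i, j) \<le> T (i, j0)"
        using * j0 e by (cases "j = j0") (auto intro!: row simp: diagonals_upto_def)
      also have "\<dots> \<le> T (i, j')" unfolding j0 using e by (intro A2)
      finally show ?thesis .
    qed
  next
    fix i i' j assume *: "(i, j) \<in> diagonals_upto m n (Suc d)" "(i', j) \<in> diagonals_upto m n (Suc d)" "i < i'"
    show "T (i, j) \<le> T (i', j)"
    proof (cases "(i, j) \<in> diagonals_upto m n d")
      case True
      then show ?thesis using * by (intro col) (auto simp: diagonals_upto_def)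
    next
      case False
      have e: "j + m = Suc i + d" "Suc i < m" "j < n" using False * by (auto simp: diagonals_upto_def)
      have "T (i, j) \<le> T (Suc i, j)" using e by (intro A1)
      also have "\<dots> \<le> T (i', j)"
        using * e by (cases "i' = Suc i") (auto intro!: col simp: diagonals_upto_def)
      finally show ?thesis .
    qed
  qed
qed

text \<open>Entries in the unit interval make the default bounds 0 and 1 automatic, so they impose
  nothing where a neighbour is missing.\<close>

lemma adjacent_iff_interlacing:
  assumes "n \<le> m" "Suc d \<le> n + m" "\<And>p. p \<in> diagonals_upto m n (Suc d) \<Longrightarrow> T p \<in> {0..1}"
  shows "(\<forall>i j. i < m \<longrightarrow> j < n \<longrightarrow> j + m = i + d \<longrightarrow>
      (i \<noteq> 0 \<longrightarrow> T (i - 1, j) \<le> T (i, j)) \<and> (Suc j < n \<longrightarrow> T (i, j) \<le> T (i, Suc j))) \<longleftrightarrow>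
    interlacing m n d (diag_of m n (Suc d) T) (diag_of m n d T)" (is "?A \<longleftrightarrow> _")
proof -
  let ?N = "diag_length m n d" and ?v = "diag_of m n (Suc d) T"
  define Q where "Q p \<longleftrightarrow> (fst p \<noteq> 0 \<longrightarrow> T (fst p - 1, snd p) \<le> T p) \<and> (Suc (snd p) < n \<longrightarrow> T p \<le> T (fst p, Suc (snd p)))" for p
  have "?A \<longleftrightarrow> (\<forall>p\<in>{(i, j). i < m \<and> j < n \<and> j + m = i + d}. Q p)" by (auto simp: Q_def)
  also have "\<dots> \<longleftrightarrow> (\<forall>t<?N. Q (diag_cell m d t))"
    using assms(1,2) by (subst diag_cells_eq[symmetric]) auto
  also have "\<dots> \<longleftrightarrow> interlacing m n d ?v (diag_of m n d T)"
    unfolding interlacing_def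
  proof (intro all_cong1 imp_cong refl)
    fix t assume t: "t < ?N"
    have T01: "T (diag_cell m d t) \<in> {0..1}"
      using assms(1,2) diag_cell_in[OF assms(1) _ t] by (intro assms(3)) (auto simp: diagonals_upto_def)
    have dg: "diag_of m n d T t = T (diag_cell m d t)" using t by (simp add: diag_of_def)
    show "Q (diag_cell m d t) \<longleftrightarrow> interlacing_bound m n d ?v t \<le> diag_of m n d T t \<and>
       diag_of m n d T t \<le> interlacing_bound m n d ?v (Suc t)"
    proof (cases "d < m")
      case True
      have 1: "t < diag_length m n (Suc d)" and 2: "Suc t < diag_length m n (Suc d) \<longleftrightarrow> Suc t < n"
        using t True by (auto simp: diag_length_def)
      have c: "diag_cell m d t = (m - d + t, t)" "diag_cell m (Suc d) t = (m - d + t - 1, t)"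
        "diag_cell m (Suc d) (Suc t) = (m - d + t, Suc t)" using True by (auto simp: diag_cell_def)
      have "interlacing_bound m n d ?v t = T (m - d + t - 1, t)"
        "interlacing_bound m n d ?v (Suc t) = (if Suc t < n then T (m - d + t, Suc t) else 1)"
        using True 1 2 c(2,3) by (auto simp: interlacing_bound_def diag_of_def)
      then show ?thesis using T01 True by (auto simp: Q_def dg c(1))
    next
      case False
      have l: "diag_length m n d = Suc (diag_length m n (Suc d))" "diag_length m n d = n + m - d"
        using False assms by (auto simp: diag_length_def)
      have 2: "t < diag_length m n (Suc d) \<longleftrightarrow> Suc (t + d - m) < n" using l assms False by auto
      have c: "diag_cell m d t = (t, t + d - m)" "diag_cell m (Suc d) t = (t, Suc (t + d - m))"
        "t \<noteq> 0 \<Longrightarrow> diag_cell m (Suc d) (t - 1) = (t - 1, t + d - m)"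
        using False by (auto simp: diag_cell_def)
      show ?thesis
      proof (cases "t = 0")
        case True
        have "interlacing_bound m n d ?v (Suc t) = (if Suc (t + d - m) < n then T (t, Suc (t + d - m)) else 1)"
          using False 2 c(2) by (auto simp: interlacing_bound_def diag_of_def Suc_le_eq)
        moreover have "interlacing_bound m n d ?v t = 0" using False True by (simp add: interlacing_bound_def)
        ultimately show ?thesis using T01 True unfolding Q_def dg c(1) by auto
      next
        case t0: False
        have "t - 1 < diag_length m n (Suc d)" using t l t0 by auto
        then have "interlacing_bound m n d ?v t = T (t - 1, t + d - m)"
          using t0 False c(3)[OF t0] by (auto simp: interlacing_bound_def diag_of_def)
        moreover have "interlacing_bound m n d ?v (Suc t) = (if Suc (t + d - m) < n then T (t, Suc (t + d - m)) else 1)"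
          using False 2 c(2) by (auto simp: interlacing_bound_def diag_of_def Suc_le_eq)
        ultimately show ?thesis using T01 t0 by (auto simp: Q_def dg c(1))
      qed
    qed
  qed
  finally show ?thesis .
qed

section \<open>Density of a diagonal and its induction step\<close>

definition diag_const :: "nat \<Rightarrow> nat \<Rightarrow> nat \<Rightarrow> real" where
  "diag_const m n d = (\<Prod>e<d. fact (e - m) * fact (e - n) / fact e)"

definition diag_density :: "nat \<Rightarrow> nat \<Rightarrow> nat \<Rightarrow> (nat \<Rightarrow> real) \<Rightarrow> real" where
  "diag_density m n d u = (let N = diag_length m n d in
     of_bool (sorted_upto N u) * (beta_weight N (d - m) (d - n) u * vandermonde N u))"

lemma diag_const_pos: "diag_const m n d > 0"
  unfolding diag_const_def by (intro prod_pos) auto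

lemma diag_density_nonneg:
  assumes "u \<in> space (cube {..<diag_length m n d})"
  shows "diag_density m n d u \<ge> 0"
  unfolding diag_density_def Let_def beta_weight_def
  using in_space_cube[OF assms] by (auto intro!: mult_nonneg_nonneg prod_nonneg vandermonde_nonneg)

lemma interlacing_imp_sorted:
  assumes "n \<le> m" "Suc d \<le> n + m" "interlacing m n d v u"
  shows "sorted_upto (diag_length m n (Suc d)) v" "sorted_upto (diag_length m n d) u"
proof -
  let ?w = "interlacing_bound m n d v"
  have w: "?w t \<le> u t" "u t \<le> ?w (Suc t)" if "t < diag_length m n d" for t
    using assms(3) that by (auto simp: interlacing_def)
  show "sorted_upto (diag_length m n d) u"
    unfolding sorted_upto_def using w(2) w(1) by (meson Suc_lessD order.trans)
  show "sorted_upto (diag_length m n (Suc d)) v"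
    unfolding sorted_upto_def
  proof (intro allI impI)
    fix t assume t: "Suc t < diag_length m n (Suc d)"
    show "v t \<le> v (Suc t)"
    proof (cases "d < m")
      case True
      then have "t < diag_length m n d" using t by (auto simp: diag_length_def)
      then have "?w t \<le> ?w (Suc t)" using w by (meson order.trans)
      then show ?thesis using t True by (simp add: interlacing_bound_def)
    next
      case False
      then have "Suc t < diag_length m n d" using t by (auto simp: diag_length_def)
      then have "?w (Suc t) \<le> ?w (Suc (Suc t))" using w by (meson order.trans)
      then show ?thesis using t False by (simp add: interlacing_bound_def)
    qed
  qed
qed

text \<open>The three box integrals cover growing, constant and shrinking diagonals. With truncated
  subtraction their constants have one common form: \<open>fact (d - m)\<close> is 1 up to
  \<open>d = m\<close>, \<open>fact (d - n)\<close> is 1 up to \<open>d = n\<close>, and the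
  denominator is always \<open>fact d\<close>.\<close>

lemma has_bochner_integral_interlacing:
  assumes "n \<le> m" "Suc d \<le> n + m" "v \<in> space (cube {..<diag_length m n (Suc d)})"
    and sorted: "sorted_upto (diag_length m n (Suc d)) v"
  defines "N \<equiv> diag_length m n d" and "w \<equiv> interlacing_bound m n d v"
  shows "has_bochner_integral (cube {..<N})
    (\<lambda>u. (\<Prod>t<N. indicator {w t..w (Suc t)} (u t)) * (beta_weight N (d - m) (d - n) u * vandermonde N u))
    (fact (d - m) * fact (d - n) / fact d * diag_density m n (Suc d) v)"
proof -
  have v01: "v t \<in> {0..1}" if "t < diag_length m n (Suc d)" for t
    using in_space_cube[OF assms(3)] that by auto
  have s: "v t \<le> v (Suc t)" if "Suc t < diag_length m n (Suc d)" for t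
    using sorted that by (auto simp: sorted_upto_def)
  consider "d < n" | "n \<le> d" "d < m" | "m \<le> d" by linarith
  then show ?thesis
  proof cases
    case 1
    have N: "N = d" "diag_length m n (Suc d) = Suc d" using 1 assms(1) by (auto simp: N_def diag_length_def)
    have w: "w t = v t" if "t \<le> d" for t using that 1 assms(1) N by (simp add: w_def interlacing_bound_def)
    have "has_bochner_integral (cube {..<N}) (\<lambda>u. (\<Prod>t<N. indicator {v t..v (Suc t)} (u t)) * vandermonde N u) (vandermonde (Suc N) v / fact N)"
      using v01 s N by (intro has_bochner_integral_interlacing_vandermonde) auto
    also have "(\<lambda>u. (\<Prod>t<N. indicator {v t..v (Suc t)} (u t)) * vandermonde N u) =
      (\<lambda>u. (\<Prod>t<N. indicator {w t..w (Suc t)} (u t)) * (beta_weight N (d - m) (d - n) u * vandermonde N u))"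
      using 1 assms(1) w N by (intro ext arg_cong2[where f = "(*)"] prod.cong) (auto simp: beta_weight_def)
    also have "vandermonde (Suc N) v / fact N = fact (d - m) * fact (d - n) / fact d * diag_density m n (Suc d) v"
      using 1 assms(1) sorted N by (simp add: diag_density_def beta_weight_def)
    finally show ?thesis .
  next
    case 2
    have N: "N = n" "diag_length m n (Suc d) = n" using 2 by (auto simp: N_def diag_length_def)
    have w: "w = (\<lambda>t. if t < N then v t else 1)" using 2 N by (simp add: w_def interlacing_bound_def fun_eq_iff)
    have "has_bochner_integral (cube {..<N})
      (\<lambda>u. (\<Prod>t<N. indicator {w t..w (Suc t)} (u t)) * ((\<Prod>t<N. (1 - u t) ^ (d - n)) * vandermonde N u))
      (fact (d - n) / fact (d - n + N) * ((\<Prod>t<N. (1 - v t) ^ Suc (d - n)) * vandermonde N v))"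
      unfolding w using v01 s N
      by (intro has_bochner_integral_interlacing_upper) (auto simp: Suc_lessI)
    also have "fact (d - n) / fact (d - n + N) * ((\<Prod>t<N. (1 - v t) ^ Suc (d - n)) * vandermonde N v) =
      fact (d - m) * fact (d - n) / fact d * diag_density m n (Suc d) v"
      using 2 sorted N by (simp add: diag_density_def beta_weight_def Suc_diff_le)
    also have "(\<lambda>u. (\<Prod>t<N. indicator {w t..w (Suc t)} (u t)) * ((\<Prod>t<N. (1 - u t) ^ (d - n)) * vandermonde N u)) =
      (\<lambda>u. (\<Prod>t<N. indicator {w t..w (Suc t)} (u t)) * (beta_weight N (d - m) (d - n) u * vandermonde N u))"
      using 2 by (simp add: beta_weight_def)
    finally show ?thesis .
  next
    case 3
    define r where "r = diag_length m n (Suc d)"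
    have N: "N = Suc r" "r = n + m - Suc d" using 3 assms(1,2) by (auto simp: N_def r_def diag_length_def)
    have w: "w = (\<lambda>t. if t = 0 then 0 else if t \<le> r then v (t - 1) else 1)"
      using 3 by (simp add: w_def interlacing_bound_def fun_eq_iff r_def)
    have mono: "w t \<le> w (Suc t)" if "t \<le> r" for t
    proof (cases t)
      case 0
      then show ?thesis using v01[of 0] that by (auto simp: w r_def)
    next
      case (Suc t')
      then show ?thesis using v01[of t'] s[of t'] that by (auto simp: w r_def)
    qed
    have "has_bochner_integral (cube {..<N})
      (\<lambda>u. (\<Prod>t<N. indicator {w t..w (Suc t)} (u t)) * ((\<Prod>t<N. u t ^ (d - m) * (1 - u t) ^ (d - n)) * vandermonde N u))
      (fact (d - m) * fact (d - n) / fact (d - m + (d - n) + 1 + r) *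
        ((\<Prod>t<r. v t ^ Suc (d - m) * (1 - v t) ^ Suc (d - n)) * vandermonde r v))"
      unfolding w N(1) using mono unfolding w by (intro has_bochner_integral_interlacing_both)
    also have "d - m + (d - n) + 1 + r = d" using 3 assms(1,2) N by simp
    also have "(\<Prod>t<r. v t ^ Suc (d - m) * (1 - v t) ^ Suc (d - n)) * vandermonde r v = diag_density m n (Suc d) v"
      using 3 sorted assms(1) by (simp add: diag_density_def Let_def beta_weight_def r_def Suc_diff_le)
    finally show ?thesis by (simp only: beta_weight_def)
  qed
qed

text \<open>If \<open>v\<close> is not sorted, nothing interlaces with it and both sides vanish;
  this is how the ordering indicator of the new density arises.\<close>

lemma nn_integral_interlacing:
  assumes "n \<le> m" "Suc d \<le> n + m" "v \<in> space (cube {..<diag_length m n (Suc d)})"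
  shows "(\<integral>\<^sup>+u. ennreal (diag_const m n d * diag_density m n d u) * of_bool (interlacing m n d v u) \<partial>cube {..<diag_length m n d})
    = ennreal (diag_const m n (Suc d) * diag_density m n (Suc d) v)"
proof (cases "sorted_upto (diag_length m n (Suc d)) v")
  case True
  let ?N = "diag_length m n d" and ?w = "interlacing_bound m n d v"
  let ?f = "\<lambda>u. (\<Prod>t<?N. indicator {?w t..?w (Suc t)} (u t)) * (beta_weight ?N (d - m) (d - n) u * vandermonde ?N u)"
  have I: "has_bochner_integral (cube {..<?N}) ?f (fact (d - m) * fact (d - n) / fact d * diag_density m n (Suc d) v)"
    using assms True by (rule has_bochner_integral_interlacing)
  have eq: "?f u = diag_density m n d u * of_bool (interlacing m n d v u)" for u
  proof (cases "interlacing m n d v u")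
    case i: True
    then have "(\<Prod>t<?N. indicator {?w t..?w (Suc t)} (u t) :: real) = 1"
      by (intro prod.neutral) (auto simp: interlacing_def)
    then show ?thesis using interlacing_imp_sorted(2)[OF assms(1,2) i] i
      by (simp add: diag_density_def Let_def)
  next
    case False
    then obtain t where "t < ?N" "u t \<notin> {?w t..?w (Suc t)}" by (auto simp: interlacing_def)
    then have "(\<Prod>t<?N. indicator {?w t..?w (Suc t)} (u t) :: real) = 0" by (intro prod_zero) (auto intro!: bexI[of _ t])
    then show ?thesis using False by simp
  qed
  have K: "diag_const m n (Suc d) = diag_const m n d * (fact (d - m) * fact (d - n) / fact d)"
    by (simp add: diag_const_def)
  have nn: "diag_density m n d u * of_bool (interlacing m n d v u) \<ge> 0" if "u \<in> space (cube {..<?N})" for u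
    using diag_density_nonneg[OF that] by simp
  have "(\<integral>\<^sup>+u. ennreal (diag_const m n d * diag_density m n d u) * of_bool (interlacing m n d v u) \<partial>cube {..<?N})
    = (\<integral>\<^sup>+u. ennreal (diag_const m n d) * ennreal (?f u) \<partial>cube {..<?N})"
  proof (rule nn_integral_cong)
    fix u assume "u \<in> space (cube {..<?N})"
    then show "ennreal (diag_const m n d * diag_density m n d u) * of_bool (interlacing m n d v u) =
      ennreal (diag_const m n d) * ennreal (?f u)"
      unfolding eq using diag_const_pos[of m n d]
      by (cases "interlacing m n d v u") (auto simp: ennreal_mult' diag_density_nonneg)
  qed
  also have "\<dots> = ennreal (diag_const m n d) * (\<integral>\<^sup>+u. ennreal (?f u) \<partial>cube {..<?N})"
    using I by (intro nn_integral_cmult) (auto simp: has_bochner_integral_iff)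
  also have "(\<integral>\<^sup>+u. ennreal (?f u) \<partial>cube {..<?N}) = ennreal (fact (d - m) * fact (d - n) / fact d * diag_density m n (Suc d) v)"
  proof (subst nn_integral_eq_integral)
    show "integrable (cube {..<?N}) ?f" using I by (simp add: has_bochner_integral_iff)
    show "AE u in cube {..<?N}. 0 \<le> ?f u"
      using AE_space by eventually_elim (simp only: eq nn)
  qed (use I in \<open>simp add: has_bochner_integral_iff\<close>)
  also have "ennreal (diag_const m n d) * \<dots> = ennreal (diag_const m n (Suc d) * diag_density m n (Suc d) v)"
    unfolding K using diag_const_pos[of m n d] by (simp add: ennreal_mult'[symmetric] mult_ac)
  finally show ?thesis .
next
  case False
  then have "\<not> interlacing m n d v u" for u
    using interlacing_imp_sorted(1)[OF assms(1,2)] by blast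
  then show ?thesis using False by (simp add: diag_density_def)
qed


lemma measurable_of_bool:
  "{x \<in> space M. P x} \<in> sets M \<Longrightarrow> (\<lambda>x. of_bool (P x) :: ennreal) \<in> borel_measurable M"
proof -
  assume "{x \<in> space M. P x} \<in> sets M"
  then have "(\<lambda>x. indicator {x \<in> space M. P x} x :: ennreal) \<in> borel_measurable M" by simp
  also have "?this \<longleftrightarrow> (\<lambda>x. of_bool (P x) :: ennreal) \<in> borel_measurable M"
    by (intro measurable_cong) (auto simp: indicator_def)
  finally show ?thesis .
qed

lemma sets_weakly_increasing:
  assumes "finite D"
  shows "{T \<in> space (cube D). weakly_increasing D T} \<in> sets (cube D)"
proof -
  have "{T \<in> space (cube D). \<forall>a\<in>D. \<forall>b\<in>D. fst a = fst b \<and> snd a < snd b \<or> snd a = snd b \<and> fst a < fst b \<longrightarrow> T a \<le> T b} \<in> sets (cube D)"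
    using assms by (intro sets_Collect_Ball_cube) (auto intro: borel_measurable_le measurable_cube_component)
  also have "{T \<in> space (cube D). \<forall>a\<in>D. \<forall>b\<in>D. fst a = fst b \<and> snd a < snd b \<or> snd a = snd b \<and> fst a < fst b \<longrightarrow> T a \<le> T b} =
    {T \<in> space (cube D). weakly_increasing D T}"
    unfolding weakly_increasing_def by (intro Collect_cong conj_cong refl) (fastforce simp: Ball_def)
  finally show ?thesis .
qed

lemma sets_interlacing: "{u \<in> space (cube {..<diag_length m n d}). interlacing m n d v u} \<in> sets (cube {..<diag_length m n d})"
proof -
  have "{u \<in> space (cube {..<diag_length m n d}). \<forall>a\<in>{..<diag_length m n d}. \<forall>b\<in>{..<diag_length m n d}. a = b \<longrightarrow>
     interlacing_bound m n d v a \<le> u a \<and> u a \<le> interlacing_bound m n d v (Suc a)} \<in> sets (cube {..<diag_length m n d})"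
    by (intro sets_Collect_Ball_cube sets.sets_Collect_conj borel_measurable_le measurable_cube_component) auto
  also have "{u \<in> space (cube {..<diag_length m n d}). \<forall>a\<in>{..<diag_length m n d}. \<forall>b\<in>{..<diag_length m n d}. a = b \<longrightarrow>
     interlacing_bound m n d v a \<le> u a \<and> u a \<le> interlacing_bound m n d v (Suc a)} =
    {u \<in> space (cube {..<diag_length m n d}). interlacing m n d v u}"
    by (auto simp: interlacing_def)
  finally show ?thesis .
qed

lemma measurable_diag_of:
  assumes "n \<le> m" "d \<le> n + m" "diag_cell m d ` {..<diag_length m n d} \<subseteq> K"
  shows "diag_of m n d \<in> measurable (cube K) (cube {..<diag_length m n d})"
  unfolding diag_of_def[abs_def] using assms(3) by (rule measurable_cube_reindex)

text \<open>The arbitrary \<open>h\<close> makes the statement one about the law of the diagonal,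
  and it drives the induction: the earlier boxes see the new diagonal only through the interlacing
  condition, which is absorbed into \<open>h\<close>.\<close>

lemma diagonal_law:
  assumes "n \<le> m" "d \<le> n + m" "h \<in> borel_measurable (cube {..<diag_length m n d})"
  shows "(\<integral>\<^sup>+T. of_bool (weakly_increasing (diagonals_upto m n d) T) * h (diag_of m n d T) \<partial>cube (diagonals_upto m n d)) =
    (\<integral>\<^sup>+u. ennreal (diag_const m n d * diag_density m n d u) * h u \<partial>cube {..<diag_length m n d})"
  using assms(2,3)
proof (induction d arbitrary: h)
  case 0
  show ?case
    by (simp add: uniform01s.nn_integral_empty diag_length_def weakly_increasing_def diag_of_def
        diag_const_def diag_density_def sorted_upto_def beta_weight_def restrict_def
        prob_space.emeasure_space_1[OF prob_space_cube])
next
  case (Suc d)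
  let ?N = "diag_length m n (Suc d)" and ?E = "diagonals_upto m n (Suc d)" and ?I = "diagonals_upto m n d"
  define J where "J = diag_cell m (Suc d) ` {..<?N}"
  have E: "?E = J \<union> ?I" "J \<inter> ?I = {}" using diagonals_upto_Suc[OF assms(1) Suc.prems(1)] by (auto simp: J_def)
  have J: "finite J" by (simp add: J_def)
  have d: "d \<le> n + m" using Suc.prems by simp
  have sub: "diag_cell m d ` {..<diag_length m n d} \<subseteq> ?I" using diag_cell_in[OF assms(1) d] by auto
  define F where "F T = of_bool (weakly_increasing ?E T) * h (diag_of m n (Suc d) T)" for T
  define v where "v y = diag_of m n (Suc d) y" for y
  have mv: "v \<in> measurable (cube J) (cube {..<?N})"
    unfolding v_def[abs_def] using assms(1) Suc.prems(1) by (intro measurable_diag_of) (auto simp: J_def)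
  have "F \<in> borel_measurable (cube ?E)"
    unfolding F_def[abs_def]
    using measurable_compose[OF measurable_diag_of[OF assms(1) Suc.prems(1)] Suc.prems(2), of ?E]
    by (intro borel_measurable_times_ennreal measurable_of_bool sets_weakly_increasing finite_diagonals_upto)
       (auto simp: E J_def)
  \<comment> \<open>The new diagonal \<open>y\<close> is the outer variable, so that the induction
    hypothesis applies to the earlier boxes with \<open>y\<close> fixed.\<close>
  then have "(\<integral>\<^sup>+T. F T \<partial>cube ?E) = (\<integral>\<^sup>+y. (\<integral>\<^sup>+x. F (merge J ?I (y, x)) \<partial>cube ?I) \<partial>cube J)"
    unfolding E(1) by (intro uniform01s.product_nn_integral_fold E(2) J finite_diagonals_upto)
  also have "\<dots> = (\<integral>\<^sup>+y. ennreal (diag_const m n (Suc d) * diag_density m n (Suc d) (v y)) * h (v y) \<partial>cube J)"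
  proof (rule nn_integral_cong)
    fix y assume y: "y \<in> space (cube J)"
    have "(\<integral>\<^sup>+x. F (merge J ?I (y, x)) \<partial>cube ?I) =
      (\<integral>\<^sup>+x. of_bool (weakly_increasing ?I x) * (of_bool (interlacing m n d (v y) (diag_of m n d x)) * h (v y)) \<partial>cube ?I)"
    proof (rule nn_integral_cong)
      fix x assume x: "x \<in> space (cube ?I)"
      define T where "T = merge J ?I (y, x)"
      have TJ: "T p = y p" if "p \<in> J" for p using that E(2) by (simp add: T_def)
      have TI: "T p = x p" if "p \<in> ?I" for p using that E(2) by (auto simp: T_def merge_def)
      have T01: "T p \<in> {0..1}" if "p \<in> ?E" for p
        using that in_space_cube[OF y, of p] in_space_cube[OF x, of p] TJ[of p] TI[of p] unfolding E(1) by auto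
      have 1: "weakly_increasing ?I T \<longleftrightarrow> weakly_increasing ?I x"
        using TI unfolding weakly_increasing_def by simp
      have 2: "diag_of m n (Suc d) T = v y"
        using TJ by (auto simp: diag_of_def v_def J_def fun_eq_iff)
      have 3: "diag_of m n d T = diag_of m n d x"
        using TI[OF subsetD[OF sub]] by (auto simp: diag_of_def fun_eq_iff)
      have "weakly_increasing ?E T \<longleftrightarrow> weakly_increasing ?I T \<and> interlacing m n d (diag_of m n (Suc d) T) (diag_of m n d T)"
        using adjacent_iff_interlacing[of n m d T, OF assms(1) Suc.prems(1)] T01
        by (simp only: weakly_increasing_Suc)
      then have W: "weakly_increasing ?E T \<longleftrightarrow> weakly_increasing ?I x \<and> interlacing m n d (v y) (diag_of m n d x)"
        unfolding 1 2 3 .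
      show "F (merge J ?I (y, x)) = of_bool (weakly_increasing ?I x) * (of_bool (interlacing m n d (v y) (diag_of m n d x)) * h (v y))"
        unfolding F_def T_def[symmetric] W 2 by simp
    qed
    also have "\<dots> = (\<integral>\<^sup>+u. ennreal (diag_const m n d * diag_density m n d u) * (of_bool (interlacing m n d (v y) u) * h (v y)) \<partial>cube {..<diag_length m n d})"
      by (intro Suc.IH d borel_measurable_times_ennreal measurable_of_bool sets_interlacing borel_measurable_const)
    also have "\<dots> = (\<integral>\<^sup>+u. ennreal (diag_const m n d * diag_density m n d u) * of_bool (interlacing m n d (v y) u) * h (v y) \<partial>cube {..<diag_length m n d})"
      by (simp add: mult.assoc)
    also have "\<dots> = (\<integral>\<^sup>+u. ennreal (diag_const m n d * diag_density m n d u) * of_bool (interlacing m n d (v y) u) \<partial>cube {..<diag_length m n d}) * h (v y)"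
    proof (rule nn_integral_multc)
      have "bounded_measurable (diag_length m n d) (diag_density m n d)"
        unfolding diag_density_def[abs_def] Let_def beta_weight_def vandermonde_index_pairs
        by (intro bounded_measurable_intros) (auto simp: index_pairs_def)
      then have "diag_density m n d \<in> borel_measurable (cube {..<diag_length m n d})"
        by (simp add: bounded_measurable_def)
      then show "(\<lambda>u. ennreal (diag_const m n d * diag_density m n d u) * of_bool (interlacing m n d (v y) u))
        \<in> borel_measurable (cube {..<diag_length m n d})"
        by (intro borel_measurable_times_ennreal measurable_of_bool sets_interlacing measurable_compose[OF _ measurable_ennreal]
            borel_measurable_times borel_measurable_const)
    qed
    also have "(\<integral>\<^sup>+u. ennreal (diag_const m n d * diag_density m n d u) * of_bool (interlacing m n d (v y) u) \<partial>cube {..<diag_length m n d})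
       = ennreal (diag_const m n (Suc d) * diag_density m n (Suc d) (v y))"
      using measurable_space[OF mv y] by (intro nn_integral_interlacing assms(1) Suc.prems(1))
    finally show "(\<integral>\<^sup>+x. F (merge J ?I (y, x)) \<partial>cube ?I) =
      ennreal (diag_const m n (Suc d) * diag_density m n (Suc d) (v y)) * h (v y)" .
  qed
  also have "\<dots> = (\<integral>\<^sup>+u. ennreal (diag_const m n (Suc d) * diag_density m n (Suc d) u) * h u \<partial>distr (cube J) (cube {..<?N}) v)"
  proof -
    have "bounded_measurable ?N (diag_density m n (Suc d))"
      unfolding diag_density_def[abs_def] Let_def beta_weight_def vandermonde_index_pairs
      by (intro bounded_measurable_intros) (auto simp: index_pairs_def)
    then have "diag_density m n (Suc d) \<in> borel_measurable (cube {..<?N})"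
      by (simp add: bounded_measurable_def)
    then have "(\<lambda>u. ennreal (diag_const m n (Suc d) * diag_density m n (Suc d) u) * h u) \<in> borel_measurable (cube {..<?N})"
      by (intro borel_measurable_times_ennreal measurable_compose[OF _ measurable_ennreal]
            borel_measurable_times borel_measurable_const Suc.prems(2))
    then show ?thesis by (subst nn_integral_distr[OF mv]) auto
  qed
  also have "distr (cube J) (cube {..<?N}) v = cube {..<?N}"
    unfolding v_def[abs_def] diag_of_def[abs_def] J_def by (rule distr_cube_reindex[OF inj_diag_cell]) simp
  finally show ?case by (simp add: F_def)
qed

subsection \<open>Counting tableaux\<close>

lemma num_syt_diagonals_upto:
  assumes "n \<le> m" "d \<le> n + m"
  shows "real (num_syt (diagonals_upto m n d)) = fact (card (diagonals_upto m n d)) *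
    (diag_const m n d * selberg_integral (diag_length m n d) (d - m) (d - n))"
proof -
  let ?D = "diagonals_upto m n d" and ?N = "diag_length m n d"
  let ?S = "{T \<in> space (cube ?D). weakly_increasing ?D T}"
  interpret D: prob_space "cube ?D" by (rule prob_space_cube)
  have sel: "selberg_integral ?N (d - m) (d - n) = (\<integral>u. diag_density m n d u \<partial>cube {..<?N})"
    by (simp add: selberg_integral_def diag_density_def Let_def)
  have int: "integrable (cube {..<?N}) (diag_density m n d)"
    unfolding diag_density_def[abs_def] Let_def beta_weight_def vandermonde_index_pairs
    by (intro bounded_measurable_integrable bounded_measurable_intros) (auto simp: index_pairs_def)
  have nn: "AE u in cube {..<?N}. 0 \<le> diag_const m n d * diag_density m n d u"
    using AE_space by eventually_elim (use diag_const_pos[of m n d] in \<open>auto intro!: mult_nonneg_nonneg diag_density_nonneg\<close>)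
  have "emeasure (cube ?D) ?S = (\<integral>\<^sup>+T. indicator ?S T \<partial>cube ?D)"
    by (rule nn_integral_indicator[symmetric, OF sets_weakly_increasing[OF finite_diagonals_upto]])
  also have "\<dots> = (\<integral>\<^sup>+T. of_bool (weakly_increasing ?D T) * 1 \<partial>cube ?D)"
    by (intro nn_integral_cong) (auto simp: indicator_def)
  also have "\<dots> = (\<integral>\<^sup>+u. ennreal (diag_const m n d * diag_density m n d u) * 1 \<partial>cube {..<?N})"
    using diagonal_law[OF assms, of "\<lambda>_. 1"] by simp
  also have "\<dots> = ennreal (\<integral>u. diag_const m n d * diag_density m n d u \<partial>cube {..<?N})"
    using int nn by (simp add: nn_integral_eq_integral)
  also have "\<dots> = ennreal (diag_const m n d * selberg_integral ?N (d - m) (d - n))"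
    by (simp add: sel)
  finally have "ennreal (D.prob ?S) = ennreal (diag_const m n d * selberg_integral ?N (d - m) (d - n))"
    by (simp add: D.emeasure_eq_measure)
  moreover have "0 \<le> diag_const m n d * selberg_integral ?N (d - m) (d - n)"
    using integral_nonneg_AE[OF nn] by (simp add: sel)
  ultimately have "D.prob ?S = diag_const m n d * selberg_integral ?N (d - m) (d - n)"
    by (simp add: measure_nonneg)
  then show ?thesis using num_syt_eq_measure[OF finite_diagonals_upto, of m n d] by simp
qed

section \<open>Constants, cardinalities and shapes\<close>

text \<open>Factorials of truncated differences are 1 at the start of the range. Dropping these and
  shifting by \<open>s\<close> turns \<open>fact (e - (r + s))\<close> into
  \<open>fact (e - r)\<close> and \<open>fact (e - s)\<close> into \<open>fact e\<close>, the latter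
  cancelling a denominator.\<close>

lemma diag_const_factor:
  assumes "r + s \<le> m"
  shows "diag_const m (r + s) (m + s) = diag_const m s (m + s) * diag_const m r m"
proof -
  have split: "(\<Prod>e<m + s. fact (e - c)) = (\<Prod>e<m. fact (e + s - c) :: real)" if "c \<ge> s" for c
  proof -
    have "(\<Prod>e<m + s. fact (e - c)) = (\<Prod>e<s. fact (e - c)) * (\<Prod>e<m. fact (e + s - c) :: real)"
      by (induction m) (auto simp: mult_ac)
    also have "(\<Prod>e<s. fact (e - c)) = (1 :: real)" using that by (intro prod.neutral) auto
    finally show ?thesis by simp
  qed
  have 1: "(\<Prod>e<m + s. fact (e - (r + s))) = (\<Prod>e<m. fact (e - r) :: real)"
    using split[of "r + s"] by simp
  have 2: "(\<Prod>e<m + s. fact (e - s)) = (\<Prod>e<m. fact e :: real)"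
    using split[of s] by simp
  have 3: "(\<Prod>e<m. fact (e - m)) = (1 :: real)" by (intro prod.neutral) auto
  have 4: "(\<Prod>e<m. fact e) \<noteq> (0 :: real)" by simp
  show ?thesis using 4
    unfolding diag_const_def prod_dividef prod.distrib 1 2 3 by simp
qed

lemma card_diagonals_upto:
  assumes "r \<le> m"
  shows "card (diagonals_upto m (r + s) (m + s)) + (r choose 2) = m * (r + s)"
proof -
  define C where "C = Sigma {..<r} (\<lambda>i. {Suc (i + s)..<r + s})"
  have "card C = (\<Sum>i<r. card {Suc (i + s)..<r + s})"
    unfolding C_def by (subst card_SigmaI) auto
  also have "\<dots> = (\<Sum>i<r. r - Suc i)" by (intro sum.cong) auto
  also have "\<dots> = (\<Sum>i<r. i)" by (rule sum.nat_diff_reindex)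
  also have "\<dots> = r choose 2"
    by (induction r) (auto simp: numeral_2_eq_2)
  finally have "card C = r choose 2" .
  moreover have "diagonals_upto m (r + s) (m + s) \<union> C = {..<m} \<times> {..<r + s}"
    "diagonals_upto m (r + s) (m + s) \<inter> C = {}"
    using assms by (auto simp: diagonals_upto_def C_def)
  moreover have "finite C" by (simp add: C_def)
  ultimately show ?thesis
    using card_Un_disjoint[OF finite_diagonals_upto \<open>finite C\<close>, of m "r + s" "m + s"] by (simp add: card_cartesian_product)
qed

text \<open>An inequality suffices, since transposing twice is the identity.\<close>

lemma num_syt_transpose_le:
  assumes "finite D"
  shows "num_syt D \<le> num_syt (prod.swap ` D)"
proof -
  let ?t = "\<lambda>T. \<lambda>p\<in>prod.swap ` D. T (prod.swap p)"
  have "finite (standard_tableaux (prod.swap ` D))"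
    by (rule finite_subset[OF _ card_rankings(1)[of "prod.swap ` D"]])
       (use assms in \<open>auto simp: standard_tableaux_def rankings_def\<close>)
  moreover have "inj_on ?t (standard_tableaux D)"
  proof (rule inj_onI)
    fix S T assume *: "S \<in> standard_tableaux D" "T \<in> standard_tableaux D" "?t S = ?t T"
    show "S = T"
    proof (rule extensionalityI)
      show "S \<in> extensional D" "T \<in> extensional D" using * by (auto simp: standard_tableaux_def)
      fix p assume "p \<in> D"
      then show "S p = T p" using fun_cong[OF *(3), of "prod.swap p"] by (auto simp: image_iff split: if_splits)
    qed
  qed
  moreover have "?t ` standard_tableaux D \<subseteq> standard_tableaux (prod.swap ` D)"
  proof safe
    fix T assume T: "T \<in> standard_tableaux D"
    have c: "card (prod.swap ` D) = card D" by (simp add: card_image)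
    have "bij_betw (T \<circ> prod.swap) (prod.swap ` D) {1..card D}"
      by (rule bij_betw_trans[of _ _ D]) (use T in \<open>auto simp: standard_tableaux_def bij_betw_def image_image\<close>)
    then have "bij_betw (?t T) (prod.swap ` D) {1..card D}"
      by (rule bij_betw_cong[THEN iffD1, rotated]) simp
    moreover have mem: "(i, j) \<in> prod.swap ` D \<longleftrightarrow> (j, i) \<in> D" for i j by force
    ultimately show "?t T \<in> standard_tableaux (prod.swap ` D)"
      using T unfolding standard_tableaux_def by (simp add: c mem)
  qed
  ultimately show ?thesis unfolding num_syt_def by (metis card_inj_on_le)
qed

lemma num_syt_transpose:
  assumes "finite D"
  shows "num_syt (prod.swap ` D) = num_syt D"
  using num_syt_transpose_le[OF assms] num_syt_transpose_le[of "prod.swap ` D"] assms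
  by (simp add: image_image)

lemma truncated_diagram_eq:
  assumes "k < n" "n \<le> m"
  shows "truncated_diagram (replicate m n) (staircase k) = diagonals_upto m n (m + (n - k - 1))"
  using assms by (auto simp: truncated_diagram_def diagonals_upto_def Defs.part_def staircase_def split: if_splits)

text \<open>The sweep runs through all diagonals, so the final one is empty and its integral is
  1.\<close>

lemma straight_diagram_rectangle: "straight_diagram (replicate m s) = diagonals_upto m s (m + s)"
  by (auto simp: straight_diagram_def diagonals_upto_def Defs.part_def split: if_splits)

text \<open>After transposition the shifted rows become columns cut off by the main diagonal, where
  the sweep stops at \<open>d = m\<close>.\<close>

lemma shifted_diagram_trapezoid:
  assumes "r \<le> m"
  shows "shifted_diagram (map (\<lambda>i. m - i) [0..<r]) = prod.swap ` diagonals_upto m r m"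
  using assms by (force simp: shifted_diagram_def diagonals_upto_def Defs.part_def split: if_splits)

lemma selberg_integral_0: "selberg_integral 0 s b = 1"
  by (simp add: selberg_integral_def sorted_upto_def beta_weight_def prob_space.prob_space[OF prob_space_cube])

theorem theorem2:
  fixes n m k :: nat
  assumes "1 \<le> n" and "n \<le> m" and "k \<le> n - 1"
  shows "real (num_syt (truncated_diagram (replicate m n) (staircase k))) =
    real ((m * n - ((k + 1) choose 2)) choose (m * (n - k - 1))) *
    real (f_straight (replicate m (n - k - 1))) *
    real (g_shifted (map (\<lambda>i. m - i) [0..<k + 1])) *
    (E1 (k + 1) m (n - k - 1) / E1 (k + 1) m 0)"
proof -
  define r s where "r = k + 1" and "s = n - k - 1"
  have n: "n = r + s" "r \<le> m" "s \<le> m" "r + s \<le> m" "k < n" using assms by (auto simp: r_def s_def)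
  define N where "N = card (diagonals_upto m n (m + s))"
  define N0 where "N0 = card (diagonals_upto m r m)"
  have cN: "N + (r choose 2) = m * n" using card_diagonals_upto[OF n(2), of s] by (simp add: N_def n(1))
  have cN0: "N0 + (r choose 2) = m * r" using card_diagonals_upto[OF n(2), of 0] by (simp add: N0_def)
  have c1: "card (diagonals_upto m s (m + s)) = m * s" using card_diagonals_upto[of 0 m s] by (simp add: numeral_2_eq_2)
  have NN: "N = m * s + N0" using cN cN0 by (simp add: n(1) algebra_simps)
  define A where "A = selberg_integral r 0 (m - r)"
  define B where "B = selberg_integral r s (m - r)"
  have AB: "B * E1 r m 0 = A * E1 r m s" unfolding A_def B_def by (rule selberg_integral_E1[OF n(2)])
  have D: "truncated_diagram (replicate m n) (staircase k) = diagonals_upto m n (m + s)"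
    unfolding s_def using n(5) assms(2) by (rule truncated_diagram_eq)
  \<comment> \<open>At \<open>d = m + s\<close> the last diagonal has length
    \<open>n - s = r\<close> and exponents \<open>d - m = s\<close> and
    \<open>d - n = m - r\<close>.\<close>
  have T: "real (num_syt (truncated_diagram (replicate m n) (staircase k))) = fact N * (diag_const m n (m + s) * B)"
    unfolding D using num_syt_diagonals_upto[of n m "m + s"] n
    by (simp add: N_def B_def diag_length_def)
  have f: "real (f_straight (replicate m s)) = fact (m * s) * diag_const m s (m + s)"
    using num_syt_diagonals_upto[of s m "m + s"] n
    by (simp add: f_straight_def straight_diagram_rectangle c1 diag_length_def selberg_integral_0)
  have g: "real (g_shifted (map (\<lambda>i. m - i) [0..<r])) = fact N0 * (diag_const m r m * A)"
    using num_syt_diagonals_upto[of r m m] n(2)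
    by (simp add: g_shifted_def shifted_diagram_trapezoid num_syt_transpose finite_diagonals_upto
        N0_def A_def diag_length_def del: upt_Suc)
  \<comment> \<open>The boxes of the rectangle and of the trapezoid add up to \<open>N\<close>, so
    the binomial coefficient converts their two factorials into \<open>fact N\<close>.\<close>
  have bin: "real (N choose (m * s)) * fact (m * s) * fact N0 = fact N"
  proof -
    have "fact (m * s) * fact N0 * (N choose (m * s)) = (fact N :: nat)"
      using binomial_fact_lemma[of "m * s" N] by (simp add: NN)
    then have "real (fact (m * s) * fact N0 * (N choose (m * s))) = real (fact N)" by simp
    then show ?thesis by (simp add: mult_ac)
  qed
  have "fact N * (diag_const m n (m + s) * B) = fact N * (diag_const m s (m + s) * diag_const m r m) * (A * (E1 r m s / E1 r m 0))"
    unfolding n(1) diag_const_factor[OF n(4)] using AB E1_pos[OF n(2), of 0] by (simp add: field_simps)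
  also have "\<dots> = real (N choose (m * s)) * (fact (m * s) * diag_const m s (m + s)) * (fact N0 * (diag_const m r m * A)) *
      (E1 r m s / E1 r m 0)"
    unfolding bin[symmetric] by simp
  also have "\<dots> = real (N choose (m * s)) * real (f_straight (replicate m s)) * real (g_shifted (map (\<lambda>i. m - i) [0..<r])) *
      (E1 r m s / E1 r m 0)"
    unfolding f g ..
  finally have main: "real (num_syt (truncated_diagram (replicate m n) (staircase k))) = \<dots>"
    unfolding T .
  have "N = m * n - (r choose 2)" using cN by simp
  then show ?thesis unfolding main by (simp only: r_def s_def)
qed

end
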